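(* Let $(A_n)$ be a sequence of real $n\times n$ matrices with $\mathrm{Tr}(A_n^TA_n)=n$ and \[\lim_{n\to\infty}\frac{1}{n}\sum_{i=1}^n(A_n)_{ii}=s\] for some constant $s$. Let $M$ be an $n\times n$ Haar-distributed random orthogonal matrix and $P$ an $n\times n$ uniformly random permutation matrix independent of $M$. Let $Z\sim\mathcal{N}(0,1-s^2)$ and $Y\sim\mathrm{Pois}(1)$ be independent. Then \[\mathrm{Tr}(A_nMPM^T)\xrightarrow{d}Z+sY\quad\text{as } n\to\infty.\]
   Context: Haar measure on $O(n)$ is the unique left- and right-invariant probability measure. *)

theory Defs
  imports "HOL-Probability.Probability"
begin

text \<open>Real n-by-n matrices are represented as functions nat => nat => real;
  only the entries with both indices below n are relevant.\<close>

definition mat_mult :: "nat \<Rightarrow> (nat \<Rightarrow> nat \<Rightarrow> real) \<Rightarrow> (nat \<Rightarrow> nat \<Rightarrow> real) \<Rightarrow> (nat \<Rightarrow> nat \<Rightarrow> real)" where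
  "mat_mult n A B = (\<lambda>i j. \<Sum>k<n. A i k * B k j)"

definition transp_mat :: "(nat \<Rightarrow> nat \<Rightarrow> real) \<Rightarrow> (nat \<Rightarrow> nat \<Rightarrow> real)" where
  "transp_mat A = (\<lambda>i j. A j i)"

definition mat_trace :: "nat \<Rightarrow> (nat \<Rightarrow> nat \<Rightarrow> real) \<Rightarrow> real" where
  "mat_trace n A = (\<Sum>i<n. A i i)"

definition perm_mat :: "(nat \<Rightarrow> nat) \<Rightarrow> (nat \<Rightarrow> nat \<Rightarrow> real)" where
  "perm_mat \<sigma> = (\<lambda>i j. if \<sigma> j = i then 1 else 0)"

definition orth_group :: "nat \<Rightarrow> (nat \<Rightarrow> nat \<Rightarrow> real) set" where
  "orth_group n = {M. (\<forall>i j. (n \<le> i \<or> n \<le> j) \<longrightarrow> M i j = 0) \<and>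
      (\<forall>i<n. \<forall>j<n. mat_mult n M (transp_mat M) i j = (if i = j then 1 else 0))}"

definition haar_orth :: "nat \<Rightarrow> (nat \<Rightarrow> nat \<Rightarrow> real) measure \<Rightarrow> bool" where
  "haar_orth n H \<longleftrightarrow> prob_space H \<and> sets H = sets (restrict_space borel (orth_group n)) \<and>
     (\<forall>U\<in>orth_group n. distr H H (\<lambda>M. mat_mult n U M) = H \<and> distr H H (\<lambda>M. mat_mult n M U) = H)"

definition unif_perm :: "nat \<Rightarrow> (nat \<Rightarrow> nat) measure" where
  "unif_perm n = measure_pmf (pmf_of_set {\<sigma>. \<sigma> permutes {..<n}})"

definition trace_law :: "nat \<Rightarrow> (nat \<Rightarrow> nat \<Rightarrow> real) measure \<Rightarrow> (nat \<Rightarrow> nat \<Rightarrow> real) \<Rightarrow> real measure" where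
  "trace_law n H A = distr (H \<Otimes>\<^sub>M unif_perm n) borel
     (\<lambda>(M, \<sigma>). mat_trace n (mat_mult n (mat_mult n (mat_mult n A M) (perm_mat \<sigma>)) (transp_mat M)))"

text \<open>Law of Z + s Y with Z ~ N(0, 1 - s^2) and Y ~ Pois(1) independent; Z is realised
  as sqrt(1 - s^2) G with G standard normal (this also covers the degenerate case s^2 = 1).\<close>
definition limit_law :: "real \<Rightarrow> real measure" where
  "limit_law s = distr (density lborel std_normal_density \<Otimes>\<^sub>M measure_pmf (poisson_pmf 1)) borel
     (\<lambda>(g, k). sqrt (1 - s\<^sup>2) * g + s * real k)"

end

theory Submission
  imports Defs "HOL-Real_Asymp.Real_Asymp"
begin

text \<open>
  Put \<open>B = M\<^sup>T A M\<close>, so that the trace is the sum of the entries \<open>B j (\<sigma> j)\<close>. Replacing \<open>M\<close> by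
  \<open>M D\<close> with a random diagonal sign matrix \<open>D\<close> does not change its law and multiplies \<open>B j (\<sigma> j)\<close>
  by \<open>\<epsilon> j * \<epsilon> (\<sigma> j)\<close>. These signs are independent once one index per cycle of \<open>\<sigma>\<close> is left out, and
  a random permutation has only about \<open>ln n\<close> cycles. Hence, given \<open>M\<close> and \<open>\<sigma>\<close>, the trace is a sum
  over the fixed points, which is close to \<open>s\<close> times a Poisson variable because \<open>B j j\<close> concentrates
  at \<open>s\<close>, plus a Rademacher sum whose variance, the sum of \<open>(B j (\<sigma> j))\<^sup>2\<close> over the other indices,
  concentrates at \<open>1 - s\<^sup>2\<close>. The second and fourth moments of \<open>B\<close> that this needs follow from
  invariance under sign changes and under reflections mixing two coordinates. The characteristic
  functions then converge.
\<close>

text \<open>One index per cycle has to go because the factors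
  \<open>\<epsilon> j * \<epsilon> (\<sigma> j)\<close> multiply to 1 around a cycle; this is the
  only relation among them. Each moved index left out costs order \<open>n\<close> to the power -1/2
  in mean, against a mean number of cycles of at most \<open>harm n\<close>, so the loss vanishes.

  The variance \<open>1 - s\<^sup>2\<close> comes from conservation: the squares of the entries of
  \<open>B\<close> always add up to \<open>n\<close>, the diagonal carries about
  \<open>n * s\<^sup>2\<close> of this, and \<open>\<sigma>\<close> picks one entry from each row.

  Joint moments of several columns of \<open>M\<close> are never computed. The squared norm of a row
  of \<open>B\<close> is a quadratic form in a single column of \<open>M\<close>, so one-column
  fourth moments control it, and invariance under reflections spreads that control evenly over the
  off-diagonal entries of the row.

  Conditioning is done by finite averages, over sign sets and then over permutations, with error
  bounds linear in the numbers of cycles and fixed points, so that only first moments of these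
  counts are needed.\<close>

section \<open>Random permutations\<close>

text \<open>If \<open>\<sigma>\<close> permutes \<open>{..<n}\<close>, the least element of an invariant set is the least element
  of its own cycle, so this set contains exactly one point of each cycle.\<close>

definition cycle_minima :: "nat \<Rightarrow> (nat \<Rightarrow> nat) \<Rightarrow> nat set" where
  "cycle_minima n \<sigma> = {j. \<exists>K\<subseteq>{..<n}. j \<in> K \<and> \<sigma> ` K \<subseteq> K \<and> (\<forall>k\<in>K. j \<le> k)}"

definition fixed_points :: "nat \<Rightarrow> (nat \<Rightarrow> nat) \<Rightarrow> nat set" where
  "fixed_points n \<sigma> = {j. j < n \<and> \<sigma> j = j}"

lemma cycle_minima_subset: "cycle_minima n \<sigma> \<subseteq> {..<n}"
  unfolding cycle_minima_def by blast

lemma finite_cycle_minima [simp]: "finite (cycle_minima n \<sigma>)"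
  using finite_subset[OF cycle_minima_subset] by blast

lemma fixed_points_subset: "fixed_points n \<sigma> \<subseteq> cycle_minima n \<sigma>"
proof
  fix j assume "j \<in> fixed_points n \<sigma>"
  then show "j \<in> cycle_minima n \<sigma>"
    unfolding cycle_minima_def fixed_points_def by (intro CollectI exI[of _ "{j}"]) auto
qed

lemma finite_fixed_points [simp]: "finite (fixed_points n \<sigma>)"
  unfolding fixed_points_def by simp

text \<open>The least element of a nonempty invariant set is a cycle minimum, with the set itself as
  witness. The sign argument uses this in the form that no nonempty set of the remaining indices is
  closed under \<open>\<sigma>\<close>.\<close>

lemma invariant_set_meets_cycle_minima:
  assumes "K \<subseteq> {..<n} - cycle_minima n \<sigma>" "\<sigma> ` K \<subseteq> K"
  shows "K = {}"
proof (rule ccontr)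
  assume "K \<noteq> {}"
  moreover have fin: "finite K"
    using assms(1) finite_subset by blast
  ultimately have "Min K \<in> cycle_minima n \<sigma>"
    unfolding cycle_minima_def using assms by (intro CollectI exI[of _ K]) auto
  then show False
    using assms(1) Min_in[OF fin \<open>K \<noteq> {}\<close>] by blast
qed

text \<open>Composing with the transposition splices \<open>n\<close> into the cycle of
  \<open>q\<close> through \<open>b\<close>, just before \<open>b\<close>, or leaves it as a fixed
  point when \<open>b = n\<close>. Being the largest index, \<open>n\<close> is not the minimum of a
  cycle that it is spliced into. An inclusion is enough, since only an upper bound on the count is
  wanted.\<close>

lemma cycle_minima_insert:
  assumes q: "q permutes {..<n}" and b: "b \<le> n"
  shows "cycle_minima (Suc n) (Transposition.transpose n b \<circ> q) \<subseteq> cycle_minima n q \<union> (if b = n then {n} else {})"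
proof
  let ?s = "Transposition.transpose n b \<circ> q"
  fix j assume "j \<in> cycle_minima (Suc n) ?s"
  then obtain K where K: "K \<subseteq> {..<Suc n}" "j \<in> K" "?s ` K \<subseteq> K" "\<forall>k\<in>K. j \<le> k"
    unfolding cycle_minima_def by blast
  have qn: "q n = n"
    using q by (simp add: permutes_not_in)
  show "j \<in> cycle_minima n q \<union> (if b = n then {n} else {})"
  proof (cases "j = n")
    case True
    then have "K = {n}"
      using K by fastforce
    then have "b = n"
      using K(3) qn by auto
    then show ?thesis
      using True by simp
  next
    case False
    have "q ` (K - {n}) \<subseteq> K - {n}"
    proof
      fix y assume "y \<in> q ` (K - {n})"
      then obtain x where x: "x \<in> K" "x \<noteq> n" "y = q x"
        by blast
      have "x < n"
        using x K(1) by fastforce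
      then have "y < n"
        using q x(3) permutes_in_image[OF q, of x] by simp
      have sx: "Transposition.transpose n b y \<in> K"
        using K(3) x by auto
      have "y \<in> K"
      \<comment> \<open>If \<open>q x = b\<close>, the composite sends \<open>x\<close> to
        \<open>n\<close> and \<open>n\<close> to \<open>b\<close>, so \<open>b\<close> is reached
        within \<open>K\<close> in two steps.\<close>
      proof (cases "y = b")
        case True
        then have "n \<in> K"
          using sx by simp
        then have "Transposition.transpose n b (q n) \<in> K"
          using K(3) by auto
        then show ?thesis
          using qn True by simp
      next
        case False
        then show ?thesis
          using sx \<open>y < n\<close> by simp
      qed
      then show "y \<in> K - {n}"
        using \<open>y < n\<close> by simp
    qed
    then have "j \<in> cycle_minima n q"
      unfolding cycle_minima_def using K False
      by (intro CollectI exI[of _ "K - {n}"]) (auto simp: less_Suc_eq)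
    then show ?thesis by simp
  qed
qed

text \<open>Building permutations of \<open>Suc n\<close> points by splicing in \<open>n\<close>
  gives the recursion S(n+1) \<le> (n+1) S(n) + n!. After division by (n+1)! the mean grows by at
  most 1/(n+1), hence the harmonic number.\<close>

lemma sum_card_cycle_minima_le:
  "(\<Sum>\<sigma> | \<sigma> permutes {..<n}. real (card (cycle_minima n \<sigma>))) \<le> fact n * harm n"
proof (induction n)
  case 0
  have "cycle_minima 0 \<sigma> = {}" for \<sigma>
    using cycle_minima_subset[of 0 \<sigma>] by auto
  then show ?case by (simp add: harm_def)
next
  case (Suc n)
  have "(\<Sum>\<sigma> | \<sigma> permutes {..<Suc n}. real (card (cycle_minima (Suc n) \<sigma>)))
     = (\<Sum>b\<in>{..<Suc n}. \<Sum>q | q permutes {..<n}. real (card (cycle_minima (Suc n) (Transposition.transpose n b \<circ> q))))"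
    using sum_over_permutations_insert[of "{..<n}" n "\<lambda>\<sigma>. real (card (cycle_minima (Suc n) \<sigma>))"]
    by (simp add: lessThan_Suc)
  also have "\<dots> \<le> (\<Sum>b\<in>{..<Suc n}. \<Sum>q | q permutes {..<n}. real (card (cycle_minima n q)) + (if b = n then 1 else 0))"
  proof (intro sum_mono)
    fix b q assume "b \<in> {..<Suc n}" "q \<in> {q. q permutes {..<n}}"
    then have "cycle_minima (Suc n) (Transposition.transpose n b \<circ> q) \<subseteq> cycle_minima n q \<union> (if b = n then {n} else {})"
      by (intro cycle_minima_insert) auto
    then have "card (cycle_minima (Suc n) (Transposition.transpose n b \<circ> q)) \<le> card (cycle_minima n q \<union> (if b = n then {n} else {}))"
      by (intro card_mono) auto
    also have "\<dots> \<le> card (cycle_minima n q) + (if b = n then 1 else 0)"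
      by (rule order_trans[OF card_Un_le]) auto
    finally have "card (cycle_minima (Suc n) (Transposition.transpose n b \<circ> q)) \<le> card (cycle_minima n q) + (if b = n then 1 else 0)" .
    then show "real (card (cycle_minima (Suc n) (Transposition.transpose n b \<circ> q))) \<le> real (card (cycle_minima n q)) + (if b = n then 1 else 0)"
      by (cases "b = n") auto
  qed
  also have "\<dots> = real (Suc n) * (\<Sum>q | q permutes {..<n}. real (card (cycle_minima n q))) + fact n"
    by (simp add: sum.distrib card_permutations if_distrib[of "\<lambda>x. _ * x"] cong: if_cong)
  also have "\<dots> \<le> real (Suc n) * (fact n * harm n) + fact n"
    using Suc by (intro add_right_mono mult_left_mono) auto
  also have "\<dots> = fact (Suc n) * harm (Suc n)"
    by (simp add: harm_Suc field_simps)
  finally show ?case .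
qed

text \<open>Composition with \<open>inv p\<close> turns agreement with \<open>p\<close> on
  \<open>S\<close> into fixing \<open>S\<close> pointwise, that is, into permuting
  \<open>A - S\<close>.\<close>

lemma card_permutes_agreeing:
  assumes "finite A" and p: "p permutes A" and "S \<subseteq> A"
  shows "card {\<sigma>. \<sigma> permutes A \<and> (\<forall>x\<in>S. \<sigma> x = p x)} = fact (card A - card S)"
proof -
  have "bij_betw (\<lambda>\<tau>. p \<circ> \<tau>) {\<tau>. \<tau> permutes A - S} {\<sigma>. \<sigma> permutes A \<and> (\<forall>x\<in>S. \<sigma> x = p x)}"
  proof (rule bij_betwI[where g = "\<lambda>\<sigma>. inv p \<circ> \<sigma>"])
    show "(\<lambda>\<tau>. p \<circ> \<tau>) \<in> {\<tau>. \<tau> permutes A - S} \<rightarrow> {\<sigma>. \<sigma> permutes A \<and> (\<forall>x\<in>S. \<sigma> x = p x)}"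
    proof (intro Pi_I CollectI conjI ballI)
      fix \<tau> assume "\<tau> \<in> {\<tau>. \<tau> permutes A - S}"
      then have \<tau>: "\<tau> permutes A - S" by simp
      then show "p \<circ> \<tau> permutes A"
        using p by (intro permutes_compose permutes_subset[OF \<tau>]) auto
      show "(p \<circ> \<tau>) x = p x" if "x \<in> S" for x
        using that permutes_not_in[OF \<tau>, of x] by simp
    qed
    show "(\<lambda>\<sigma>. inv p \<circ> \<sigma>) \<in> {\<sigma>. \<sigma> permutes A \<and> (\<forall>x\<in>S. \<sigma> x = p x)} \<rightarrow> {\<tau>. \<tau> permutes A - S}"
    proof (intro Pi_I CollectI)
      fix \<sigma> assume "\<sigma> \<in> {\<sigma>. \<sigma> permutes A \<and> (\<forall>x\<in>S. \<sigma> x = p x)}"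
      then show "inv p \<circ> \<sigma> permutes A - S"
        using permutes_compose[OF _ permutes_inv[OF p]]
        by (auto simp: permutes_inverses[OF p] intro: permutes_superset[of _ A])
    qed
  qed (simp_all add: fun_eq_iff permutes_inverses[OF p])
  then have "card {\<sigma>. \<sigma> permutes A \<and> (\<forall>x\<in>S. \<sigma> x = p x)} = card {\<tau>. \<tau> permutes A - S}"
    by (simp add: bij_betw_same_card)
  also have "\<dots> = fact (card A - card S)"
    using assms by (intro card_permutations) (auto simp: card_Diff_subset[OF finite_subset])
  finally show ?thesis .
qed

lemma card_permutes_one_value:
  assumes "j < n" "l < n"
  shows "card {\<sigma>. \<sigma> permutes {..<n} \<and> \<sigma> j = l} = fact (n - 1)"
  using card_permutes_agreeing[of "{..<n}" "Transposition.transpose j l" "{j}"] assms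
  by (simp add: permutes_swap_id)

lemma card_permutes_two_values:
  assumes "j < n" "k < n" "j \<noteq> k" "l < n" "m < n" "l \<noteq> m"
  shows "card {\<sigma>. \<sigma> permutes {..<n} \<and> \<sigma> j = l \<and> \<sigma> k = m} = fact (n - 2)"
proof -
  \<comment> \<open>\<open>k'\<close> is where the first transposition has put \<open>k\<close>. The
    second one carries it on to \<open>m\<close> and leaves \<open>l\<close> alone, because
    \<open>l\<close> is neither \<open>k'\<close> nor \<open>m\<close>.\<close>
  define k' where "k' = Transposition.transpose j l k"
  define p where "p = Transposition.transpose k' m \<circ> Transposition.transpose j l"
  have k': "k' < n" "k' \<noteq> l"
    using assms unfolding k'_def by (auto simp: Transposition.transpose_def)
  have "p permutes {..<n}"
    unfolding p_def using assms k' by (intro permutes_compose permutes_swap_id) auto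
  moreover have "p j = l" "p k = m"
    unfolding p_def using k' assms by (simp_all flip: k'_def)
  ultimately show ?thesis
    using card_permutes_agreeing[of "{..<n}" p "{j, k}"] assms by (simp add: eval_nat_numeral)
qed

section \<open>Permutation averages of functions of one or two values\<close>

lemma sum_permutes_one_value:
  fixes f :: "nat \<Rightarrow> real"
  assumes "j < n"
  shows "(\<Sum>\<sigma> | \<sigma> permutes {..<n}. f (\<sigma> j)) = fact (n - 1) * (\<Sum>l<n. f l)"
proof -
  have "(\<Sum>\<sigma> | \<sigma> permutes {..<n}. f (\<sigma> j))
      = (\<Sum>l<n. \<Sum>\<sigma> | \<sigma> \<in> {\<sigma>. \<sigma> permutes {..<n}} \<and> \<sigma> j = l. f (\<sigma> j))"
    using assms by (intro sum.group[symmetric]) (auto simp: finite_permutations dest: permutes_in_image[of _ _ j])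
  also have "\<dots> = (\<Sum>l<n. \<Sum>\<sigma> | \<sigma> permutes {..<n} \<and> \<sigma> j = l. f l)"
    by (intro sum.cong) auto
  also have "\<dots> = (\<Sum>l<n. fact (n - 1) * f l)"
    using assms by (intro sum.cong) (auto simp: card_permutes_one_value)
  finally show ?thesis by (simp add: sum_distrib_left)
qed

lemma sum_permutes_two_values:
  fixes f :: "nat \<Rightarrow> nat \<Rightarrow> real"
  assumes "j < n" "k < n" "j \<noteq> k"
  shows "(\<Sum>\<sigma> | \<sigma> permutes {..<n}. f (\<sigma> j) (\<sigma> k)) = fact (n - 2) * (\<Sum>l<n. \<Sum>m\<in>{..<n} - {l}. f l m)"
proof -
  let ?P = "SIGMA l:{..<n}. {..<n} - {l}"
  have "(\<Sum>\<sigma> | \<sigma> permutes {..<n}. f (\<sigma> j) (\<sigma> k))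
      = (\<Sum>x\<in>?P. \<Sum>\<sigma> | \<sigma> \<in> {\<sigma>. \<sigma> permutes {..<n}} \<and> (\<sigma> j, \<sigma> k) = x. f (\<sigma> j) (\<sigma> k))"
  proof (intro sum.group[symmetric])
    show "(\<lambda>\<sigma>. (\<sigma> j, \<sigma> k)) ` {\<sigma>. \<sigma> permutes {..<n}} \<subseteq> ?P"
    proof
      fix x assume "x \<in> (\<lambda>\<sigma>. (\<sigma> j, \<sigma> k)) ` {\<sigma>. \<sigma> permutes {..<n}}"
      then obtain \<sigma> where \<sigma>: "\<sigma> permutes {..<n}" "x = (\<sigma> j, \<sigma> k)"
        by blast
      have "\<sigma> j \<noteq> \<sigma> k"
        using assms(3) inj_eq[OF permutes_inj[OF \<sigma>(1)]] by simp
      then show "x \<in> ?P"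
        using assms permutes_in_image[OF \<sigma>(1), of j] permutes_in_image[OF \<sigma>(1), of k] \<sigma>(2) by simp
    qed
  qed (auto simp: finite_permutations)
  also have "\<dots> = (\<Sum>x\<in>?P. \<Sum>\<sigma> | \<sigma> permutes {..<n} \<and> \<sigma> j = fst x \<and> \<sigma> k = snd x. f (fst x) (snd x))"
    by (intro sum.cong) auto
  also have "\<dots> = (\<Sum>x\<in>?P. fact (n - 2) * f (fst x) (snd x))"
    using assms by (intro sum.cong) (auto simp: card_permutes_two_values)
  also have "\<dots> = (\<Sum>l<n. \<Sum>m\<in>{..<n} - {l}. fact (n - 2) * f l m)"
    by (subst sum.Sigma) (auto simp: case_prod_beta)
  finally show ?thesis by (simp add: sum_distrib_left)
qed

lemma sum_permutes_diagonal:
  fixes c :: "nat \<Rightarrow> nat \<Rightarrow> real"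
  shows "(\<Sum>\<sigma> | \<sigma> permutes {..<n}. \<Sum>j<n. c j (\<sigma> j)) = fact (n - 1) * (\<Sum>j<n. \<Sum>l<n. c j l)"
  by (subst sum.swap) (simp add: sum_permutes_one_value sum_distrib_left)

text \<open>Two distinct positions take distinct values, uniformly among such pairs. Nonnegativity
  of \<open>c\<close> allows the restrictions \<open>j \<noteq> k\<close> and
  \<open>l \<noteq> m\<close> to be dropped, which completes the cross terms to a full
  square.\<close>

lemma sum_permutes_diagonal_square_le:
  fixes c :: "nat \<Rightarrow> nat \<Rightarrow> real"
  assumes c: "\<And>j l. c j l \<ge> 0"
  shows "(\<Sum>\<sigma> | \<sigma> permutes {..<n}. (\<Sum>j<n. c j (\<sigma> j))\<^sup>2)
     \<le> fact (n - 1) * (\<Sum>j<n. \<Sum>l<n. (c j l)\<^sup>2) + fact (n - 2) * (\<Sum>j<n. \<Sum>l<n. c j l)\<^sup>2"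
proof -
  have "(\<Sum>\<sigma> | \<sigma> permutes {..<n}. (\<Sum>j<n. c j (\<sigma> j))\<^sup>2)
     = (\<Sum>\<sigma> | \<sigma> permutes {..<n}. \<Sum>j<n. \<Sum>k<n. c j (\<sigma> j) * c k (\<sigma> k))"
    by (simp add: power2_eq_square sum_product)
  also have "\<dots> = (\<Sum>j<n. \<Sum>k<n. \<Sum>\<sigma> | \<sigma> permutes {..<n}. c j (\<sigma> j) * c k (\<sigma> k))"
    by (subst sum.swap, intro sum.cong refl, subst sum.swap) simp
  also have "\<dots> \<le> (\<Sum>j<n. \<Sum>k<n. (if k = j then fact (n - 1) * (\<Sum>l<n. (c j l)\<^sup>2) else 0) +
        fact (n - 2) * (\<Sum>l<n. \<Sum>m<n. c j l * c k m))"
  proof (intro sum_mono)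
    fix j k assume jk: "j \<in> {..<n}" "k \<in> {..<n}"
    show "(\<Sum>\<sigma> | \<sigma> permutes {..<n}. c j (\<sigma> j) * c k (\<sigma> k)) \<le>
      (if k = j then fact (n - 1) * (\<Sum>l<n. (c j l)\<^sup>2) else 0) + fact (n - 2) * (\<Sum>l<n. \<Sum>m<n. c j l * c k m)"
    proof (cases "k = j")
      case True
      then show ?thesis
        using jk sum_permutes_one_value[of j n "\<lambda>l. (c j l)\<^sup>2"] c
        by (auto simp: power2_eq_square intro!: mult_nonneg_nonneg sum_nonneg)
    next
      case False
      have "(\<Sum>l<n. \<Sum>m\<in>{..<n} - {l}. c j l * c k m) \<le> (\<Sum>l<n. \<Sum>m<n. c j l * c k m)"
        using c by (intro sum_mono sum_mono2) auto
      then show ?thesis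
        using jk False sum_permutes_two_values[of j n k "\<lambda>l m. c j l * c k m"]
        by simp
    qed
  qed
  also have "\<dots> = fact (n - 1) * (\<Sum>j<n. \<Sum>l<n. (c j l)\<^sup>2) +
      fact (n - 2) * (\<Sum>j<n. \<Sum>k<n. (\<Sum>l<n. \<Sum>m<n. c j l * c k m))"
    by (simp add: sum.distrib sum_distrib_left)
  also have "(\<Sum>j<n. \<Sum>k<n. (\<Sum>l<n. \<Sum>m<n. c j l * c k m)) = (\<Sum>j<n. \<Sum>l<n. c j l)\<^sup>2"
    by (simp add: power2_eq_square sum_product)
  finally show ?thesis .
qed

section \<open>Fixed points and the Poisson limit\<close>

lemma sum_card_fixed_points:
  assumes "n > 0"
  shows "(\<Sum>\<sigma> | \<sigma> permutes {..<n}. real (card (fixed_points n \<sigma>))) = fact n"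
proof -
  have "real (card (fixed_points n \<sigma>)) = (\<Sum>j<n. if \<sigma> j = j then 1 else 0)" for \<sigma>
    unfolding fixed_points_def by (subst sum.If_cases) (auto simp: Int_def)
  then have "(\<Sum>\<sigma> | \<sigma> permutes {..<n}. real (card (fixed_points n \<sigma>)))
      = (\<Sum>\<sigma> | \<sigma> permutes {..<n}. \<Sum>j<n. (\<lambda>j l. if l = j then 1 else 0) j (\<sigma> j))"
    by simp
  also have "\<dots> = fact (n - 1) * real n"
    by (subst sum_permutes_diagonal) simp
  finally show ?thesis
    using assms by (simp add: fact_reduce mult.commute)
qed

text \<open>Expanding \<open>((z - 1) + 1)\<close> to the number of fixed points gives a sum over
  sets \<open>S\<close> of fixed points. Each \<open>S\<close> of size \<open>k\<close> is fixed by
  \<open>fact (n - k)\<close> permutations, and the binomial coefficient cancels this to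
  \<open>fact n / fact k\<close>. The result is a truncated exponential series, so the Poisson limit
  needs no further estimate.\<close>

lemma fixed_points_generating_function:
  fixes z :: complex
  shows "(\<Sum>\<sigma> | \<sigma> permutes {..<n}. z ^ card (fixed_points n \<sigma>)) / fact n = (\<Sum>k\<le>n. (z - 1) ^ k / fact k)"
proof -
  have exp: "z ^ card (fixed_points n \<sigma>) = (\<Sum>S\<in>Pow {..<n}. if \<forall>x\<in>S. \<sigma> x = x then (z - 1) ^ card S else 0)" for \<sigma>
  proof -
    have "z ^ card (fixed_points n \<sigma>) = (\<Prod>j\<in>fixed_points n \<sigma>. (z - 1) + 1)"
      by simp
    also have "\<dots> = (\<Sum>S\<in>Pow (fixed_points n \<sigma>). (z - 1) ^ card S)"
      by (subst prod_add) auto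
    also have "\<dots> = (\<Sum>S\<in>Pow {..<n}. if \<forall>x\<in>S. \<sigma> x = x then (z - 1) ^ card S else 0)"
      by (intro sum.mono_neutral_cong_left) (auto simp: fixed_points_def)
    finally show ?thesis .
  qed
  have "(\<Sum>\<sigma> | \<sigma> permutes {..<n}. z ^ card (fixed_points n \<sigma>))
      = (\<Sum>S\<in>Pow {..<n}. \<Sum>\<sigma> | \<sigma> permutes {..<n}. if \<forall>x\<in>S. \<sigma> x = x then (z - 1) ^ card S else 0)"
    unfolding exp by (rule sum.swap)
  also have "\<dots> = (\<Sum>S\<in>Pow {..<n}. fact (n - card S) * (z - 1) ^ card S)"
  proof (intro sum.cong refl)
    fix S assume S: "S \<in> Pow {..<n}"
    have "(\<Sum>\<sigma> | \<sigma> permutes {..<n}. if \<forall>x\<in>S. \<sigma> x = x then (z - 1) ^ card S else 0)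
       = (\<Sum>\<sigma> | \<sigma> permutes {..<n} \<and> (\<forall>x\<in>S. \<sigma> x = id x). (z - 1) ^ card S)"
      by (intro sum.mono_neutral_cong_right) (auto simp: finite_permutations)
    also have "\<dots> = fact (n - card S) * (z - 1) ^ card S"
      using card_permutes_agreeing[of "{..<n}" id S] S by (simp add: permutes_id)
    finally show "(\<Sum>\<sigma> | \<sigma> permutes {..<n}. if \<forall>x\<in>S. \<sigma> x = x then (z - 1) ^ card S else 0)
        = fact (n - card S) * (z - 1) ^ card S" .
  qed
  also have "\<dots> = (\<Sum>k\<le>n. \<Sum>S | S \<in> Pow {..<n} \<and> card S = k. fact (n - card S) * (z - 1) ^ card S)"
    by (intro sum.group[symmetric]) (auto intro: subset_eq_atLeast0_lessThan_card simp: lessThan_atLeast0)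
  also have "\<dots> = (\<Sum>k\<le>n. of_nat (n choose k) * fact (n - k) * (z - 1) ^ k)"
    by (intro sum.cong) (auto simp: n_subsets)
  also have "\<dots> = (\<Sum>k\<le>n. fact n * ((z - 1) ^ k / fact k))"
    by (intro sum.cong) (auto simp: binomial_fact field_simps)
  also have "\<dots> = fact n * (\<Sum>k\<le>n. (z - 1) ^ k / fact k)"
    by (rule sum_distrib_left[symmetric])
  finally show ?thesis
    by simp
qed

lemma fixed_points_generating_function_tendsto:
  fixes z :: complex
  shows "(\<lambda>n. (\<Sum>\<sigma> | \<sigma> permutes {..<n}. z ^ card (fixed_points n \<sigma>)) / fact n) \<longlonglongrightarrow> exp (z - 1)"
proof -
  have "(\<lambda>k. (z - 1) ^ k / fact k) sums exp (z - 1)"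
    using exp_converges[of "z - 1"] by (simp add: scaleR_conv_of_real field_simps)
  then show ?thesis
    unfolding fixed_points_generating_function sums_def_le .
qed

section \<open>Random signs\<close>

text \<open>A sign vector is encoded by the set of its negative positions, so that averaging over
  all sign vectors is a finite sum over \<open>Pow {..<n}\<close>.\<close>

definition sgn_at :: "nat set \<Rightarrow> nat \<Rightarrow> real" where
  "sgn_at E j = (if j \<in> E then -1 else 1)"

lemma sgn_at_cases: "sgn_at E j = 1 \<or> sgn_at E j = -1"
  by (simp add: sgn_at_def)

text \<open>The product over \<open>K\<close> contains the sign of a point of \<open>\<sigma> ` K - K\<close> exactly once,
  so flipping that sign changes the sign of the product.\<close>

lemma sum_prod_signs_eq_0:
  assumes \<sigma>: "\<sigma> permutes {..<n}" and K: "K \<subseteq> {..<n}" and "\<not> \<sigma> ` K \<subseteq> K"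
  shows "(\<Sum>E\<in>Pow {..<n}. \<Prod>j\<in>K. sgn_at E j * sgn_at E (\<sigma> j)) = 0"
proof -
  obtain w where w: "w \<in> K" "\<sigma> w \<notin> K"
    using assms(3) by blast
  define v where "v = \<sigma> w"
  define fl where "fl E = (if v \<in> E then E - {v} else insert v E)" for E
  have "v < n"
    using \<sigma> w K permutes_in_image[OF \<sigma>, of w] by (auto simp: v_def)
  have finK: "finite K"
    using K finite_subset by blast
  define g where "g E = (\<Prod>j\<in>K. sgn_at E j * sgn_at E (\<sigma> j))" for E
  have other: "sgn_at (fl E) j = sgn_at E j" if "j \<noteq> v" for E j
    using that by (auto simp: sgn_at_def fl_def)
  have flipped: "sgn_at (fl E) v = - sgn_at E v" for E
    by (auto simp: sgn_at_def fl_def)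
  have g: "g (fl E) = - g E" for E
  proof -
    have "(\<Prod>j\<in>K - {w}. sgn_at (fl E) j * sgn_at (fl E) (\<sigma> j)) = (\<Prod>j\<in>K - {w}. sgn_at E j * sgn_at E (\<sigma> j))"
    proof (intro prod.cong refl)
      fix j assume "j \<in> K - {w}"
      \<comment> \<open>\<open>v\<close> is outside \<open>K\<close>, and
        \<open>\<sigma> j = v\<close> would force \<open>j = w\<close> by injectivity. Hence only
        the factor at \<open>w\<close> sees the flip.\<close>
      then have "j \<noteq> v" "\<sigma> j \<noteq> v"
        using w inj_eq[OF permutes_inj[OF \<sigma>]] by (auto simp: v_def)
      then show "sgn_at (fl E) j * sgn_at (fl E) (\<sigma> j) = sgn_at E j * sgn_at E (\<sigma> j)"
        by (simp add: other)
    qed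
    moreover have "w \<noteq> v"
      using w by (auto simp: v_def)
    ultimately show ?thesis
      unfolding g_def using w finK by (simp add: prod.remove[of K w] other flipped flip: v_def)
  qed
  \<comment> \<open>\<open>fl\<close> is an involution of the power set, so the sum equals its own
    negative.\<close>
  have "(\<Sum>E\<in>Pow {..<n}. g E) = (\<Sum>E\<in>Pow {..<n}. g (fl E))"
    using \<open>v < n\<close> by (intro sum.reindex_bij_witness[of _ fl fl]) (auto simp: fl_def insert_absorb)
  also have "\<dots> = - (\<Sum>E\<in>Pow {..<n}. g E)"
    by (simp add: g sum_negf)
  finally show ?thesis
    by (simp add: g_def)
qed

text \<open>The product is expanded over subsets \<open>K\<close> of \<open>J\<close>. A nonempty
  \<open>K\<close> avoids the cycle minima, so it is not invariant and its sign product averages to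
  0; only the empty set survives. Thus affine functions of the signs behave as if the signs were
  independent with mean zero.\<close>

lemma sum_prod_signs_affine:
  fixes \<alpha> \<beta> :: "nat \<Rightarrow> complex"
  assumes \<sigma>: "\<sigma> permutes {..<n}"
  defines "J \<equiv> {..<n} - cycle_minima n \<sigma>"
  shows "(\<Sum>E\<in>Pow {..<n}. \<Prod>j\<in>J. \<alpha> j + \<beta> j * of_real (sgn_at E j * sgn_at E (\<sigma> j))) = 2 ^ n * (\<Prod>j\<in>J. \<alpha> j)"
proof -
  let ?\<eta> = "\<lambda>E j. sgn_at E j * sgn_at E (\<sigma> j)"
  have "(\<Sum>E\<in>Pow {..<n}. \<Prod>j\<in>J. \<beta> j * of_real (?\<eta> E j) + \<alpha> j)
     = (\<Sum>E\<in>Pow {..<n}. \<Sum>K\<in>Pow J. (\<Prod>j\<in>K. \<beta> j) * (\<Prod>j\<in>J - K. \<alpha> j) * of_real (\<Prod>j\<in>K. ?\<eta> E j))"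
    by (subst prod_add) (auto simp: J_def prod.distrib intro!: sum.cong)
  also have "\<dots> = (\<Sum>K\<in>Pow J. (\<Prod>j\<in>K. \<beta> j) * (\<Prod>j\<in>J - K. \<alpha> j) * of_real (\<Sum>E\<in>Pow {..<n}. \<Prod>j\<in>K. ?\<eta> E j))"
    by (subst sum.swap) (simp add: sum_distrib_left)
  also have "\<dots> = (\<Sum>K\<in>Pow J. if K = {} then 2 ^ n * (\<Prod>j\<in>J. \<alpha> j) else 0)"
  proof (intro sum.cong refl)
    fix K assume K: "K \<in> Pow J"
    show "(\<Prod>j\<in>K. \<beta> j) * (\<Prod>j\<in>J - K. \<alpha> j) * of_real (\<Sum>E\<in>Pow {..<n}. \<Prod>j\<in>K. ?\<eta> E j)
       = (if K = {} then 2 ^ n * (\<Prod>j\<in>J. \<alpha> j) else 0)"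
    proof (cases "K = {}")
      case True
      then show ?thesis by (simp add: card_Pow)
    next
      case False
      then have "\<not> \<sigma> ` K \<subseteq> K"
        using K invariant_set_meets_cycle_minima[of K n \<sigma>] by (auto simp: J_def)
      moreover have "K \<subseteq> {..<n}"
        using K by (auto simp: J_def)
      ultimately show ?thesis
        using sum_prod_signs_eq_0[OF \<sigma>] False by simp
    qed
  qed
  also have "\<dots> = 2 ^ n * (\<Prod>j\<in>J. \<alpha> j)"
    by (simp add: J_def)
  finally show ?thesis by (simp add: add.commute)
qed

text \<open>For a sign \<open>\<eta>\<close>, \<open>iexp (\<eta> * c)\<close> equals
  \<open>cos c + \<i> * \<eta> * sin c\<close>, which is affine in \<open>\<eta>\<close>; averaging
  keeps the cosines.\<close>

lemma sum_iexp_signs: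
  fixes c :: "nat \<Rightarrow> real"
  assumes \<sigma>: "\<sigma> permutes {..<n}"
  defines "J \<equiv> {..<n} - cycle_minima n \<sigma>"
  shows "(\<Sum>E\<in>Pow {..<n}. iexp (\<Sum>j\<in>J. sgn_at E j * sgn_at E (\<sigma> j) * c j)) = 2 ^ n * of_real (\<Prod>j\<in>J. cos (c j))"
proof -
  have "iexp (\<Sum>j\<in>J. sgn_at E j * sgn_at E (\<sigma> j) * c j)
      = (\<Prod>j\<in>J. of_real (cos (c j)) + \<i> * of_real (sin (c j)) * of_real (sgn_at E j * sgn_at E (\<sigma> j)))" for E
  proof -
    have "iexp (\<Sum>j\<in>J. sgn_at E j * sgn_at E (\<sigma> j) * c j) = (\<Prod>j\<in>J. iexp (sgn_at E j * sgn_at E (\<sigma> j) * c j))"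
      by (simp add: sum_distrib_left exp_sum J_def)
    also have "\<dots> = (\<Prod>j\<in>J. of_real (cos (c j)) + \<i> * of_real (sin (c j)) * of_real (sgn_at E j * sgn_at E (\<sigma> j)))"
    proof (intro prod.cong refl)
      fix j
      show "iexp (sgn_at E j * sgn_at E (\<sigma> j) * c j)
         = of_real (cos (c j)) + \<i> * of_real (sin (c j)) * of_real (sgn_at E j * sgn_at E (\<sigma> j))"
        using sgn_at_cases[of E j] sgn_at_cases[of E "\<sigma> j"]
        by (auto simp: complex_eq_iff Re_exp Im_exp)
    qed
    finally show ?thesis .
  qed
  then show ?thesis
    using sum_prod_signs_affine[OF \<sigma>, of "\<lambda>j. of_real (cos (c j))" "\<lambda>j. \<i> * of_real (sin (c j))"]
    by (simp add: J_def)
qed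

text \<open>Both functions agree with \<open>1 - x\<^sup>2 / 2\<close> up to a fourth-order error,
  with constants 1/24 and 1/8; the constant 1 is a convenient upper bound for their sum.\<close>

lemma abs_cos_minus_exp_le: "\<bar>cos x - exp (- x\<^sup>2 / 2)\<bar> \<le> (x::real) ^ 4"
proof -
  have c: "\<bar>cos x - (1 - x\<^sup>2 / 2)\<bar> \<le> x ^ 4 / 24"
  proof -
    obtain t where "cos x = (\<Sum>m<4. cos_coeff m * x ^ m) + cos (t + 1 / 2 * real 4 * pi) / fact 4 * x ^ 4"
      using Maclaurin_cos_expansion[of x 4] by blast
    moreover have "{..<4} = {0, 1, 2, 3::nat}"
      by auto
    ultimately have "cos x - (1 - x\<^sup>2 / 2) = cos (t + 2 * pi) * (x ^ 4 / 24)"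
      by (simp add: cos_coeff_def fact_numeral)
    then have "\<bar>cos x - (1 - x\<^sup>2 / 2)\<bar> = \<bar>cos (t + 2 * pi)\<bar> * (x ^ 4 / 24)"
      by (simp only: abs_mult) simp
    also have "\<dots> \<le> 1 * (x ^ 4 / 24)"
      by (intro mult_right_mono abs_cos_le_one) auto
    finally show ?thesis by simp
  qed
  have e: "\<bar>exp (- x\<^sup>2 / 2) - (1 - x\<^sup>2 / 2)\<bar> \<le> x ^ 4 / 8"
  proof -
    define y where "y = x\<^sup>2 / 2"
    have "y \<ge> 0" by (simp add: y_def)
    \<comment> \<open>The upper bound for \<open>exp (- y)\<close> comes from the lower bound for
      \<open>exp y\<close>: the quadratics \<open>1 - y + y\<^sup>2 / 2\<close> and
      \<open>1 + y + y\<^sup>2 / 2\<close> have a product of at least 1.\<close>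
    have "exp (- y) * (1 + y + y\<^sup>2 / 2) \<le> exp (- y) * exp y"
      using exp_lower_Taylor_quadratic[OF \<open>y \<ge> 0\<close>] by (intro mult_left_mono) auto
    also have "\<dots> = 1" by (simp flip: exp_add)
    also have "1 \<le> 1 + (y\<^sup>2)\<^sup>2 / 4"
      by simp
    also have "\<dots> = (1 - y + y\<^sup>2 / 2) * (1 + y + y\<^sup>2 / 2)"
      by (simp add: algebra_simps power2_eq_square)
    finally have "exp (- y) \<le> 1 - y + y\<^sup>2 / 2"
      by (rule mult_right_le_imp_le) (use \<open>y \<ge> 0\<close> in \<open>auto intro!: add_pos_nonneg\<close>)
    moreover have "1 - y \<le> exp (- y)"
      using exp_ge_add_one_self[of "- y"] by simp
    moreover have "y\<^sup>2 / 2 = x ^ 4 / 8"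
      by (simp add: y_def power_divide flip: power_mult)
    ultimately show ?thesis
      unfolding y_def by simp
  qed
  have "x ^ 4 \<ge> 0" by simp
  then show ?thesis using c e by linarith
qed

section \<open>Bounded measurable functions\<close>

text \<open>The integrands over the orthogonal group are built from matrix entries, which are
  bounded by 1, by arithmetic, absolute values, cosines and \<open>iexp\<close>. This class is
  closed under these operations and gives integrability over any probability measure, so
  integrability can be checked by the shape of the term.\<close>

definition bdd_measurable :: "'a measure \<Rightarrow> ('a \<Rightarrow> 'b::{real_normed_field, banach, second_countable_topology}) \<Rightarrow> bool" where
  "bdd_measurable H f \<longleftrightarrow> f \<in> borel_measurable H \<and> (\<exists>C. \<forall>x\<in>space H. norm (f x) \<le> C)"

lemma bdd_measurableI:
  "f \<in> borel_measurable H \<Longrightarrow> (\<And>x. x \<in> space H \<Longrightarrow> norm (f x) \<le> C) \<Longrightarrow> bdd_measurable H f"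
  unfolding bdd_measurable_def by blast

lemma bdd_measurable_measurable: "bdd_measurable H f \<Longrightarrow> f \<in> borel_measurable H"
  unfolding bdd_measurable_def by blast

lemma bdd_measurable_const: "bdd_measurable H (\<lambda>x. c)"
  by (rule bdd_measurableI[where C = "norm c"]) auto

lemma bdd_measurable_add:
  assumes "bdd_measurable H f" "bdd_measurable H g"
  shows "bdd_measurable H (\<lambda>x. f x + g x)"
proof -
  from assms obtain C D where
    "\<And>x. x \<in> space H \<Longrightarrow> norm (f x) \<le> C" "\<And>x. x \<in> space H \<Longrightarrow> norm (g x) \<le> D"
    unfolding bdd_measurable_def by blast
  then show ?thesis
    using assms[THEN bdd_measurable_measurable]
    by (intro bdd_measurableI[where C = "C + D"] norm_triangle_mono) auto
qed

lemma bdd_measurable_mult: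
  assumes "bdd_measurable H f" "bdd_measurable H g"
  shows "bdd_measurable H (\<lambda>x. f x * g x)"
proof -
  from assms obtain C D where
    "\<And>x. x \<in> space H \<Longrightarrow> norm (f x) \<le> C" "\<And>x. x \<in> space H \<Longrightarrow> norm (g x) \<le> D"
    unfolding bdd_measurable_def by blast
  then show ?thesis
    using assms[THEN bdd_measurable_measurable]
    by (intro bdd_measurableI[where C = "C * D"])
      (auto simp: norm_mult intro!: mult_mono intro: order_trans[OF norm_ge_zero])
qed

lemma bdd_measurable_diff:
  assumes "bdd_measurable H f" "bdd_measurable H g"
  shows "bdd_measurable H (\<lambda>x. f x - g x)"
  using bdd_measurable_add[OF assms(1) bdd_measurable_mult[OF bdd_measurable_const[of H "-1"] assms(2)]]
  by simp

lemma bdd_measurable_divide_const: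
  "bdd_measurable H f \<Longrightarrow> bdd_measurable H (\<lambda>x. f x / c)"
  using bdd_measurable_mult[OF _ bdd_measurable_const[of H "inverse c"], of f]
  by (simp add: divide_inverse)

lemma bdd_measurable_power: "bdd_measurable H f \<Longrightarrow> bdd_measurable H (\<lambda>x. f x ^ k)"
  by (induction k) (simp_all add: bdd_measurable_const bdd_measurable_mult)

lemma bdd_measurable_sum:
  "(\<And>i. i \<in> I \<Longrightarrow> bdd_measurable H (f i)) \<Longrightarrow> bdd_measurable H (\<lambda>x. \<Sum>i\<in>I. f i x)"
  by (induction I rule: infinite_finite_induct) (simp_all add: bdd_measurable_const bdd_measurable_add)

lemma bdd_measurable_prod:
  "(\<And>i. i \<in> I \<Longrightarrow> bdd_measurable H (f i)) \<Longrightarrow> bdd_measurable H (\<lambda>x. \<Prod>i\<in>I. f i x)"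
  by (induction I rule: infinite_finite_induct) (simp_all add: bdd_measurable_const bdd_measurable_mult)

lemma bdd_measurable_norm:
  assumes "bdd_measurable H f" shows "bdd_measurable H (\<lambda>x. norm (f x))"
proof -
  from assms obtain C where "\<And>x. x \<in> space H \<Longrightarrow> norm (f x) \<le> C"
    unfolding bdd_measurable_def by blast
  then show ?thesis
    using assms[THEN bdd_measurable_measurable] by (intro bdd_measurableI[where C = C]) auto
qed

lemma bdd_measurable_abs:
  fixes f :: "'a \<Rightarrow> real"
  shows "bdd_measurable H f \<Longrightarrow> bdd_measurable H (\<lambda>x. \<bar>f x\<bar>)"
  using bdd_measurable_norm[of H f] by simp

lemma bdd_measurable_of_real:
  fixes f :: "'a \<Rightarrow> real"
  assumes "bdd_measurable H f" shows "bdd_measurable H (\<lambda>x. complex_of_real (f x))"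
proof -
  from assms obtain C where "\<And>x. x \<in> space H \<Longrightarrow> norm (f x) \<le> C"
    unfolding bdd_measurable_def by blast
  then show ?thesis
    using assms[THEN bdd_measurable_measurable] by (intro bdd_measurableI[where C = C]) auto
qed

lemma bdd_measurable_iexp:
  fixes f :: "'a \<Rightarrow> real"
  assumes "bdd_measurable H f" shows "bdd_measurable H (\<lambda>x. iexp (f x))"
  using assms[THEN bdd_measurable_measurable] by (intro bdd_measurableI[where C = 1]) auto

lemma bdd_measurable_cos:
  fixes f :: "'a \<Rightarrow> real"
  assumes "bdd_measurable H f" shows "bdd_measurable H (\<lambda>x. cos (f x))"
  using assms[THEN bdd_measurable_measurable] by (intro bdd_measurableI[where C = 1]) auto

lemmas bdd_measurable_intros =
  bdd_measurable_const bdd_measurable_add bdd_measurable_diff bdd_measurable_mult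
  bdd_measurable_divide_const bdd_measurable_power bdd_measurable_sum bdd_measurable_prod
  bdd_measurable_abs bdd_measurable_norm bdd_measurable_of_real bdd_measurable_iexp bdd_measurable_cos

lemma (in prob_space) integrable_bdd_measurable:
  assumes "bdd_measurable M f" shows "integrable M f"
proof -
  from assms obtain C where "\<And>x. x \<in> space M \<Longrightarrow> norm (f x) \<le> C"
    unfolding bdd_measurable_def by blast
  then show ?thesis
    using bdd_measurable_measurable[OF assms] by (intro integrable_const_bound[where B = C]) auto
qed

lemma (in prob_space) square_expectation_le:
  fixes f :: "'a \<Rightarrow> real"
  assumes "bdd_measurable M f"
  shows "(\<integral>x. f x \<partial>M)\<^sup>2 \<le> (\<integral>x. (f x)\<^sup>2 \<partial>M)"
  using variance_positive[of f] variance_eq[of f] assms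
  by (simp add: integrable_bdd_measurable bdd_measurable_power)

lemma (in prob_space) expectation_abs_le_sqrt:
  fixes f :: "'a \<Rightarrow> real"
  assumes "bdd_measurable M f" "(\<integral>x. (f x)\<^sup>2 \<partial>M) \<le> c"
  shows "(\<integral>x. \<bar>f x\<bar> \<partial>M) \<le> sqrt c"
proof -
  have "(\<integral>x. \<bar>f x\<bar> \<partial>M)\<^sup>2 \<le> c"
    using square_expectation_le[OF bdd_measurable_abs[OF assms(1)]] assms(2) by simp
  then show ?thesis
    by (rule real_le_rsqrt)
qed

text \<open>Expanding the two rotated fourth powers expresses each fourth moment as one quarter of
  both plus 6/4 of the mixed moment, since the odd terms vanish. So the two are equal and are three
  times the mixed moment, as for independent centred Gaussians of equal variance. It serves both for
  entries of one column of \<open>M\<close> and for off-diagonal entries of one row of the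
  conjugated matrix.\<close>

lemma (in prob_space) fourth_moments_45_degrees:
  fixes x y :: "'a \<Rightarrow> real"
  assumes [intro]: "bdd_measurable M x" "bdd_measurable M y"
    and plus: "(\<integral>\<omega>. ((x \<omega> + y \<omega>) / sqrt 2) ^ 4 \<partial>M) = (\<integral>\<omega>. x \<omega> ^ 4 \<partial>M)"
    and minus: "(\<integral>\<omega>. ((x \<omega> - y \<omega>) / sqrt 2) ^ 4 \<partial>M) = (\<integral>\<omega>. y \<omega> ^ 4 \<partial>M)"
    and odd: "(\<integral>\<omega>. x \<omega> ^ 3 * y \<omega> \<partial>M) = 0" "(\<integral>\<omega>. x \<omega> * y \<omega> ^ 3 \<partial>M) = 0"
  shows "(\<integral>\<omega>. x \<omega> ^ 4 \<partial>M) = 3 * (\<integral>\<omega>. x \<omega> ^ 2 * y \<omega> ^ 2 \<partial>M)"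
    and "(\<integral>\<omega>. y \<omega> ^ 4 \<partial>M) = 3 * (\<integral>\<omega>. x \<omega> ^ 2 * y \<omega> ^ 2 \<partial>M)"
proof -
  note [simp] = integrable_bdd_measurable bdd_measurable_intros assms(1,2)
  have sqrt4: "sqrt 2 ^ 4 = (4 :: real)"
    using power_mult[of "sqrt 2 :: real" 2 2] by simp
  have p: "((a + b) / sqrt 2) ^ 4 = (a ^ 4 + b ^ 4 + 6 * (a\<^sup>2 * b\<^sup>2) + 4 * (a ^ 3 * b) + 4 * (a * b ^ 3)) / 4" for a b :: real
    unfolding power_divide sqrt4 by (simp add: algebra_simps power2_eq_square power3_eq_cube power4_eq_xxxx)
  have m: "((a - b) / sqrt 2) ^ 4 = (a ^ 4 + b ^ 4 + 6 * (a\<^sup>2 * b\<^sup>2) - 4 * (a ^ 3 * b) - 4 * (a * b ^ 3)) / 4" for a b :: real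
    unfolding power_divide sqrt4 by (simp add: algebra_simps power2_eq_square power3_eq_cube power4_eq_xxxx)
  have "((\<integral>\<omega>. x \<omega> ^ 4 \<partial>M) + (\<integral>\<omega>. y \<omega> ^ 4 \<partial>M) + 6 * (\<integral>\<omega>. x \<omega> ^ 2 * y \<omega> ^ 2 \<partial>M)) / 4 = (\<integral>\<omega>. x \<omega> ^ 4 \<partial>M)"
    using plus unfolding p by (simp add: odd)
  moreover have "((\<integral>\<omega>. x \<omega> ^ 4 \<partial>M) + (\<integral>\<omega>. y \<omega> ^ 4 \<partial>M) + 6 * (\<integral>\<omega>. x \<omega> ^ 2 * y \<omega> ^ 2 \<partial>M)) / 4 = (\<integral>\<omega>. y \<omega> ^ 4 \<partial>M)"
    using minus unfolding m by (simp add: odd)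
  ultimately show "(\<integral>\<omega>. x \<omega> ^ 4 \<partial>M) = 3 * (\<integral>\<omega>. x \<omega> ^ 2 * y \<omega> ^ 2 \<partial>M)"
    "(\<integral>\<omega>. y \<omega> ^ 4 \<partial>M) = 3 * (\<integral>\<omega>. x \<omega> ^ 2 * y \<omega> ^ 2 \<partial>M)"
    by simp_all
qed

section \<open>The orthogonal group\<close>

lemma sum_rotate:
  "(\<Sum>j\<in>A. \<Sum>a\<in>B. \<Sum>b\<in>C. f j a b) = (\<Sum>a\<in>B. \<Sum>b\<in>C. \<Sum>j\<in>A. f j a b)"
  by (rule trans[OF sum.swap], intro sum.cong refl, rule sum.swap)

lemma sum_swap_pairs:
  "(\<Sum>j\<in>A. \<Sum>l\<in>B. \<Sum>i\<in>C. \<Sum>k\<in>D. f j l i k) = (\<Sum>i\<in>C. \<Sum>k\<in>D. \<Sum>j\<in>A. \<Sum>l\<in>B. f j l i k)"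
proof -
  have "(\<Sum>j\<in>A. \<Sum>l\<in>B. \<Sum>i\<in>C. \<Sum>k\<in>D. f j l i k) = (\<Sum>j\<in>A. \<Sum>i\<in>C. \<Sum>k\<in>D. \<Sum>l\<in>B. f j l i k)"
    by (intro sum.cong refl, subst sum.swap, intro sum.cong refl, rule sum.swap)
  also have "\<dots> = (\<Sum>i\<in>C. \<Sum>k\<in>D. \<Sum>j\<in>A. \<Sum>l\<in>B. f j l i k)"
    by (subst sum.swap, intro sum.cong refl, rule sum.swap)
  finally show ?thesis .
qed

lemma orth_group_entry_zero: "M \<in> orth_group n \<Longrightarrow> n \<le> i \<or> n \<le> j \<Longrightarrow> M i j = 0"
  unfolding orth_group_def by blast

lemma orth_group_rows:
  "M \<in> orth_group n \<Longrightarrow> i < n \<Longrightarrow> k < n \<Longrightarrow> (\<Sum>j<n. M i j * M k j) = (if i = k then 1 else 0)"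
  unfolding orth_group_def mat_mult_def transp_mat_def by blast

lemma orth_groupI:
  assumes "\<And>i j. n \<le> i \<or> n \<le> j \<Longrightarrow> M i j = 0"
    and "\<And>i k. i < n \<Longrightarrow> k < n \<Longrightarrow> (\<Sum>j<n. M i j * M k j) = (if i = k then 1 else 0)"
  shows "M \<in> orth_group n"
  using assms unfolding orth_group_def mat_mult_def transp_mat_def by blast

lemma orth_group_entry_le_1:
  assumes "M \<in> orth_group n" shows "\<bar>M i j\<bar> \<le> 1"
proof (cases "i < n \<and> j < n")
  case True
  have "(M i j)\<^sup>2 \<le> (\<Sum>j<n. (M i j)\<^sup>2)"
    using True by (intro member_le_sum) auto
  also have "\<dots> = 1"
    using orth_group_rows[OF assms, of i i] True by (simp add: power2_eq_square)
  finally show ?thesis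
    by (simp add: abs_square_le_1)
next
  case False
  then show ?thesis
    using orth_group_entry_zero[OF assms, of i j] by auto
qed

text \<open>\<open>I - M\<^sup>T M\<close> has squared Hilbert-Schmidt norm \<open>n - 2 n + n = 0\<close>.\<close>

lemma orth_group_columns:
  assumes M: "M \<in> orth_group n" and "j < n" "l < n"
  shows "(\<Sum>i<n. M i j * M i l) = (if j = l then 1 else 0)"
proof -
  define Q where "Q j l = (\<Sum>i<n. M i j * M i l)" for j l
  have tr: "(\<Sum>j<n. Q j j) = real n"
    unfolding Q_def using orth_group_rows[OF M] by (subst sum.swap) simp
  have "(\<Sum>j<n. \<Sum>l<n. Q j l * Q j l) = (\<Sum>j<n. \<Sum>l<n. \<Sum>i<n. \<Sum>k<n. (M i j * M k j) * (M i l * M k l))"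
    unfolding Q_def by (simp add: sum_product mult_ac)
  \<comment> \<open>The swap turns the squared norm of \<open>M\<^sup>T M\<close> into that of
    \<open>M M\<^sup>T\<close>, which the row relations evaluate.\<close>
  also have "\<dots> = (\<Sum>i<n. \<Sum>k<n. \<Sum>j<n. \<Sum>l<n. (M i j * M k j) * (M i l * M k l))"
    by (rule sum_swap_pairs)
  also have "\<dots> = (\<Sum>i<n. \<Sum>k<n. (\<Sum>j<n. M i j * M k j) * (\<Sum>l<n. M i l * M k l))"
    by (simp add: sum_product)
  also have "\<dots> = (\<Sum>i<n. \<Sum>k<n. if i = k then 1 else 0)"
    using orth_group_rows[OF M] by (intro sum.cong) auto
  finally have sq: "(\<Sum>j<n. \<Sum>l<n. Q j l * Q j l) = real n"
    by simp
  have "(\<Sum>j<n. \<Sum>l<n. ((if j = l then 1 else 0) - Q j l)\<^sup>2)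
      = (\<Sum>j<n. \<Sum>l<n. (if j = l then 1 - 2 * Q j j else 0) + Q j l * Q j l)"
    by (intro sum.cong refl) (simp add: power2_eq_square algebra_simps)
  also have "\<dots> = 0"
    using tr sq by (simp add: sum.distrib sum_subtractf flip: sum_distrib_left)
  finally have "\<forall>j\<in>{..<n}. (\<Sum>l<n. ((if j = l then 1 else 0) - Q j l)\<^sup>2) = 0"
    by (subst (asm) sum_nonneg_eq_0_iff) (auto intro!: sum_nonneg)
  then have "\<forall>j\<in>{..<n}. \<forall>l\<in>{..<n}. ((if j = l then 1 else 0) - Q j l)\<^sup>2 = 0"
    by (subst (asm) sum_nonneg_eq_0_iff) auto
  then show ?thesis
    using assms unfolding Q_def by (auto split: if_splits)
qed

lemma mat_mult_in_orth_group:
  assumes U: "U \<in> orth_group n" and M: "M \<in> orth_group n"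
  shows "mat_mult n U M \<in> orth_group n"
proof (rule orth_groupI)
  show "mat_mult n U M i j = 0" if "n \<le> i \<or> n \<le> j" for i j
    using that orth_group_entry_zero[OF U, of i] orth_group_entry_zero[OF M, of _ j]
    unfolding mat_mult_def by (auto intro!: sum.neutral)
  show "(\<Sum>j<n. mat_mult n U M i j * mat_mult n U M k j) = (if i = k then 1 else 0)" if "i < n" "k < n" for i k
  proof -
    have "(\<Sum>j<n. mat_mult n U M i j * mat_mult n U M k j)
        = (\<Sum>j<n. \<Sum>a<n. \<Sum>b<n. U i a * U k b * (M a j * M b j))"
      unfolding mat_mult_def by (simp add: sum_product mult_ac)
    also have "\<dots> = (\<Sum>a<n. \<Sum>b<n. U i a * U k b * (\<Sum>j<n. M a j * M b j))"
    proof -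
      have "(\<Sum>j<n. \<Sum>a<n. \<Sum>b<n. U i a * U k b * (M a j * M b j)) = (\<Sum>a<n. \<Sum>b<n. \<Sum>j<n. U i a * U k b * (M a j * M b j))"
        by (rule sum_rotate)
      then show ?thesis
        by (simp add: sum_distrib_left)
    qed
    also have "\<dots> = (\<Sum>a<n. \<Sum>b<n. if b = a then U i a * U k a else 0)"
      using orth_group_rows[OF M] by (intro sum.cong refl) auto
    also have "\<dots> = (\<Sum>a<n. U i a * U k a)"
      by simp
    finally show ?thesis
      using orth_group_rows[OF U that] by simp
  qed
qed

definition sign_mat :: "nat \<Rightarrow> nat set \<Rightarrow> nat \<Rightarrow> nat \<Rightarrow> real" where
  "sign_mat n E i j = (if i = j \<and> i < n then sgn_at E i else 0)"

lemma sign_mat_in_orth_group: "sign_mat n E \<in> orth_group n"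
proof (rule orth_groupI)
  show "(\<Sum>j<n. sign_mat n E i j * sign_mat n E k j) = (if i = k then 1 else 0)" if "i < n" "k < n" for i k
  proof -
    have "(\<Sum>j<n. sign_mat n E i j * sign_mat n E k j) = (\<Sum>j<n. if j = i then (if i = k then 1 else 0) else 0)"
      using that by (intro sum.cong refl) (auto simp: sign_mat_def sgn_at_def)
    then show ?thesis using that by simp
  qed
qed (auto simp: sign_mat_def)

lemma mat_mult_sign_mat_left:
  assumes "M \<in> orth_group n"
  shows "mat_mult n (sign_mat n E) M = (\<lambda>i j. sgn_at E i * M i j)"
proof (intro ext)
  fix i j
  have "mat_mult n (sign_mat n E) M i j = (\<Sum>k<n. if k = i then sgn_at E i * M i j else 0)"
    unfolding mat_mult_def sign_mat_def by (intro sum.cong) auto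
  then show "mat_mult n (sign_mat n E) M i j = sgn_at E i * M i j"
    using orth_group_entry_zero[OF assms, of i j] by auto
qed

lemma mat_mult_sign_mat_right:
  assumes "M \<in> orth_group n"
  shows "mat_mult n M (sign_mat n E) = (\<lambda>i j. M i j * sgn_at E j)"
proof (intro ext)
  fix i j
  have "mat_mult n M (sign_mat n E) i j = (\<Sum>k<n. if k = j then M i j * sgn_at E j else 0)"
    unfolding mat_mult_def sign_mat_def by (intro sum.cong) auto
  then show "mat_mult n M (sign_mat n E) i j = M i j * sgn_at E j"
    using orth_group_entry_zero[OF assms, of i j] by auto
qed

text \<open>On the coordinates \<open>a\<close> and \<open>b\<close> this is the 2-by-2 block with
  rows (1, 1) and (1, -1), divided by \<open>sqrt 2\<close>. Choosing a reflection instead of a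
  rotation makes the matrix symmetric, so one formula serves multiplication on either side.\<close>

definition refl_mat :: "nat \<Rightarrow> nat \<Rightarrow> nat \<Rightarrow> nat \<Rightarrow> nat \<Rightarrow> real" where
  "refl_mat n a b i j =
    (if n \<le> i \<or> n \<le> j then 0
     else if i = a then (if j = a \<or> j = b then 1 / sqrt 2 else 0)
     else if i = b then (if j = a then 1 / sqrt 2 else if j = b then - 1 / sqrt 2 else 0)
     else if i = j then 1 else 0)"

lemma refl_mat_sym: "a \<noteq> b \<Longrightarrow> refl_mat n a b i j = refl_mat n a b j i"
  by (auto simp: refl_mat_def)

lemma sum_refl_mat:
  assumes ab: "a < n" "b < n" "a \<noteq> b" and i: "i < n"
  shows "(\<Sum>k<n. refl_mat n a b i k * x k) =
    (if i = a then (x a + x b) / sqrt 2 else if i = b then (x a - x b) / sqrt 2 else x i)"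
proof (cases "i = a \<or> i = b")
  case True
  have "(\<Sum>k<n. refl_mat n a b i k * x k) = (\<Sum>k\<in>{a, b}. refl_mat n a b i k * x k)"
    using ab True by (intro sum.mono_neutral_right) (auto simp: refl_mat_def)
  then show ?thesis
    using True ab by (auto simp: refl_mat_def add_divide_distrib diff_divide_distrib)
next
  case False
  have "(\<Sum>k<n. refl_mat n a b i k * x k) = (\<Sum>k\<in>{i}. refl_mat n a b i k * x k)"
    using False i by (intro sum.mono_neutral_right) (auto simp: refl_mat_def)
  then show ?thesis
    using False i by (simp add: refl_mat_def)
qed

lemma refl_mat_in_orth_group:
  assumes ab: "a < n" "b < n" "a \<noteq> b"
  shows "refl_mat n a b \<in> orth_group n"
proof (rule orth_groupI)
  show "(\<Sum>j<n. refl_mat n a b i j * refl_mat n a b k j) = (if i = k then 1 else 0)" if "i < n" "k < n" for i k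
    using ab that by (subst sum_refl_mat) (auto simp: refl_mat_def field_simps)
qed (auto simp: refl_mat_def)

lemma mat_mult_refl_mat_left:
  assumes "a < n" "b < n" "a \<noteq> b" "i < n"
  shows "mat_mult n (refl_mat n a b) M i j =
    (if i = a then (M a j + M b j) / sqrt 2 else if i = b then (M a j - M b j) / sqrt 2 else M i j)"
  unfolding mat_mult_def using sum_refl_mat[OF assms, of "\<lambda>k. M k j"] by simp

lemma mat_mult_refl_mat_right:
  assumes "a < n" "b < n" "a \<noteq> b" "j < n"
  shows "mat_mult n M (refl_mat n a b) i j =
    (if j = a then (M i a + M i b) / sqrt 2 else if j = b then (M i a - M i b) / sqrt 2 else M i j)"
  unfolding mat_mult_def using sum_refl_mat[OF assms, of "\<lambda>k. M i k"] refl_mat_sym[OF assms(3), of n _ j]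
  by (simp add: mult.commute)

section \<open>Moments of Haar-distributed orthogonal matrices\<close>

locale haar_measure =
  fixes n :: nat and H :: "(nat \<Rightarrow> nat \<Rightarrow> real) measure"
  assumes haar: "haar_orth n H"
begin

sublocale prob_space H
  using haar by (simp add: haar_orth_def)

lemma sets_H: "sets H = sets (restrict_space borel (orth_group n))"
  using haar by (simp add: haar_orth_def)

lemma space_H: "space H = orth_group n"
  using sets_eq_imp_space_eq[OF sets_H] by (simp add: space_restrict_space)

lemma entry_measurable [measurable]: "(\<lambda>M. M i j) \<in> borel_measurable H"
proof -
  have "(\<lambda>M::nat \<Rightarrow> nat \<Rightarrow> real. M i j) \<in> borel_measurable borel"
    by (rule measurable_product_then_coordinatewise, rule measurable_product_coordinates)
  then have "(\<lambda>M::nat \<Rightarrow> nat \<Rightarrow> real. M i j) \<in> borel_measurable (restrict_space borel (orth_group n))"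
    by (rule measurable_restrict_space1)
  then show ?thesis
    using measurable_cong_sets[OF sets_H refl] by blast
qed

lemma bdd_measurable_entry: "bdd_measurable H (\<lambda>M. M i j)"
  by (rule bdd_measurableI[where C = 1]) (auto simp: space_H intro: orth_group_entry_le_1)

text \<open>The index type is countable, so Borel measurability into the function space can be
  tested entry by entry; membership in the group then permits the restriction.\<close>

lemma measurable_H_I:
  assumes "\<And>M. M \<in> orth_group n \<Longrightarrow> f M \<in> orth_group n"
    and "\<And>i j. (\<lambda>M. f M i j) \<in> borel_measurable H"
  shows "f \<in> measurable H H"
proof -
  have "f \<in> borel_measurable H"
    using assms(2) by (intro measurable_coordinatewise_then_product)
  then have "f \<in> measurable H (restrict_space borel (orth_group n))"
    using assms(1) by (intro measurable_restrict_space2) (auto simp: space_H)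
  then show ?thesis
    using measurable_cong_sets[OF refl sets_H] by blast
qed

lemma integral_mult_left:
  fixes f :: "_ \<Rightarrow> 'b::{banach, second_countable_topology}"
  assumes U: "U \<in> orth_group n" and f: "f \<in> borel_measurable H"
  shows "(\<integral>M. f (mat_mult n U M) \<partial>H) = (\<integral>M. f M \<partial>H)"
proof -
  have "mat_mult n U \<in> measurable H H"
    by (rule measurable_H_I) (rule mat_mult_in_orth_group[OF U], assumption, simp add: mat_mult_def)
  then have "(\<integral>M. f M \<partial>distr H H (mat_mult n U)) = (\<integral>M. f (mat_mult n U M) \<partial>H)"
    using f by (rule integral_distr)
  then show ?thesis
    using haar U by (simp add: haar_orth_def)
qed

lemma integral_mult_right:
  fixes f :: "_ \<Rightarrow> 'b::{banach, second_countable_topology}"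
  assumes U: "U \<in> orth_group n" and f: "f \<in> borel_measurable H"
  shows "(\<integral>M. f (mat_mult n M U) \<partial>H) = (\<integral>M. f M \<partial>H)"
proof -
  have "(\<lambda>M. mat_mult n M U) \<in> measurable H H"
    by (rule measurable_H_I) (erule mat_mult_in_orth_group[OF _ U], simp add: mat_mult_def)
  then have "(\<integral>M. f M \<partial>distr H H (\<lambda>M. mat_mult n M U)) = (\<integral>M. f (mat_mult n M U) \<partial>H)"
    using f by (rule integral_distr)
  then show ?thesis
    using haar U by (simp add: haar_orth_def)
qed

lemma integral_flip_rows:
  fixes f :: "_ \<Rightarrow> 'b::{banach, second_countable_topology}"
  assumes "f \<in> borel_measurable H"
  shows "(\<integral>M. f (\<lambda>i j. sgn_at E i * M i j) \<partial>H) = (\<integral>M. f M \<partial>H)"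
proof -
  have "(\<integral>M. f (\<lambda>i j. sgn_at E i * M i j) \<partial>H) = (\<integral>M. f (mat_mult n (sign_mat n E) M) \<partial>H)"
    by (intro Bochner_Integration.integral_cong refl) (simp add: mat_mult_sign_mat_left space_H)
  then show ?thesis
    using integral_mult_left[OF sign_mat_in_orth_group assms] by simp
qed

lemma integral_flip_columns:
  fixes f :: "_ \<Rightarrow> 'b::{banach, second_countable_topology}"
  assumes "f \<in> borel_measurable H"
  shows "(\<integral>M. f (\<lambda>i j. M i j * sgn_at E j) \<partial>H) = (\<integral>M. f M \<partial>H)"
proof -
  have "(\<integral>M. f (\<lambda>i j. M i j * sgn_at E j) \<partial>H) = (\<integral>M. f (mat_mult n M (sign_mat n E)) \<partial>H)"
    by (intro Bochner_Integration.integral_cong refl) (simp add: mat_mult_sign_mat_right space_H)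
  then show ?thesis
    using integral_mult_right[OF sign_mat_in_orth_group assms] by simp
qed

lemma integral_odd_row:
  fixes f :: "(nat \<Rightarrow> nat \<Rightarrow> real) \<Rightarrow> real"
  assumes "f \<in> borel_measurable H"
    and "\<And>M. f (\<lambda>i j. sgn_at {v} i * M i j) = - f M"
  shows "(\<integral>M. f M \<partial>H) = 0"
  using integral_flip_rows[OF assms(1), of "{v}"] assms(2) by simp

lemma integral_odd_column:
  fixes f :: "(nat \<Rightarrow> nat \<Rightarrow> real) \<Rightarrow> real"
  assumes "f \<in> borel_measurable H"
    and "\<And>M. f (\<lambda>i j. M i j * sgn_at {v} j) = - f M"
  shows "(\<integral>M. f M \<partial>H) = 0"
  using integral_flip_columns[OF assms(1), of "{v}"] assms(2) by simp

lemmas integrable_intros = integrable_bdd_measurable bdd_measurable_intros bdd_measurable_entry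

lemma second_moment_offdiag:
  assumes "i \<noteq> k"
  shows "(\<integral>M. M i j * M k j \<partial>H) = 0"
  by (rule integral_odd_row[where v = i]) (use assms in \<open>auto simp: sgn_at_def\<close>)

text \<open>The reflection mixing rows \<open>i\<close> and \<open>k\<close>, whose cross term
  integrates to 0, shows that all entries of the column have equal second moments; these add up to
  the squared column norm 1.\<close>

lemma second_moment:
  assumes j: "j < n" and i: "i < n"
  shows "(\<integral>M. M i j * M i j \<partial>H) = 1 / real n"
proof -
  have eq: "(\<integral>M. M k j * M k j \<partial>H) = (\<integral>M. M i j * M i j \<partial>H)" if "k < n" for k
  proof (cases "k = i")
    case False
    have "(\<integral>M. M i j * M i j \<partial>H) = (\<integral>M. ((M i j + M k j) / sqrt 2) * ((M i j + M k j) / sqrt 2) \<partial>H)"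
      using integral_mult_left[OF refl_mat_in_orth_group[of i n k], of "\<lambda>M. M i j * M i j"] i that False
      by (simp add: mat_mult_refl_mat_left)
    also have "\<dots> = (\<integral>M. (M i j * M i j + M k j * M k j) / 2 + M i j * M k j \<partial>H)"
      by (intro Bochner_Integration.integral_cong refl) (simp add: field_simps)
    also have "\<dots> = ((\<integral>M. M i j * M i j \<partial>H) + (\<integral>M. M k j * M k j \<partial>H)) / 2"
      using False by (simp add: integrable_intros second_moment_offdiag)
    finally show ?thesis by simp
  qed simp
  have "real n * (\<integral>M. M i j * M i j \<partial>H) = (\<Sum>k<n. \<integral>M. M k j * M k j \<partial>H)"
    by (simp add: eq)
  also have "\<dots> = (\<integral>M. (\<Sum>k<n. M k j * M k j) \<partial>H)"
    by (rule Bochner_Integration.integral_sum[symmetric]) (simp add: integrable_intros)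
  also have "\<dots> = (\<integral>M. 1 \<partial>H)"
    using orth_group_columns[OF _ j j] by (intro Bochner_Integration.integral_cong refl) (simp add: space_H)
  also have "\<dots> = 1"
    by (simp add: prob_space)
  finally show ?thesis
    using i by (simp add: field_simps)
qed

lemma fourth_moment_relations:
  assumes j: "j < n" and ik: "i < n" "k < n" "i \<noteq> k"
  shows "(\<integral>M. M i j ^ 4 \<partial>H) = 3 * (\<integral>M. M i j ^ 2 * M k j ^ 2 \<partial>H)"
    and "(\<integral>M. M k j ^ 4 \<partial>H) = 3 * (\<integral>M. M i j ^ 2 * M k j ^ 2 \<partial>H)"
proof -
  have 1: "(\<integral>M. ((M i j + M k j) / sqrt 2) ^ 4 \<partial>H) = (\<integral>M. M i j ^ 4 \<partial>H)"
    using integral_mult_left[OF refl_mat_in_orth_group[OF ik], of "\<lambda>M. M i j ^ 4"] ik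
    by (simp add: mat_mult_refl_mat_left)
  have 2: "(\<integral>M. ((M i j - M k j) / sqrt 2) ^ 4 \<partial>H) = (\<integral>M. M k j ^ 4 \<partial>H)"
    using integral_mult_left[OF refl_mat_in_orth_group[OF ik], of "\<lambda>M. M k j ^ 4"] ik
    by (simp add: mat_mult_refl_mat_left)
  have 3: "(\<integral>M. M i j ^ 3 * M k j \<partial>H) = 0"
    by (rule integral_odd_row[where v = k]) (use ik in \<open>auto simp: sgn_at_def\<close>)
  have 4: "(\<integral>M. M i j * M k j ^ 3 \<partial>H) = 0"
    by (rule integral_odd_row[where v = i]) (use ik in \<open>auto simp: sgn_at_def\<close>)
  show "(\<integral>M. M i j ^ 4 \<partial>H) = 3 * (\<integral>M. M i j ^ 2 * M k j ^ 2 \<partial>H)"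
    "(\<integral>M. M k j ^ 4 \<partial>H) = 3 * (\<integral>M. M i j ^ 2 * M k j ^ 2 \<partial>H)"
    using fourth_moments_45_degrees[OF bdd_measurable_entry bdd_measurable_entry 1 2 3 4] by blast+
qed

text \<open>With \<open>\<gamma>\<close> the common fourth moment, every mixed moment is
  \<open>\<gamma> / 3\<close>. Squaring the unit column norm gives 1 = n \<gamma> + n (n - 1)
  \<gamma> / 3 = n (n + 2) \<gamma> / 3, whence the denominator.\<close>

lemma fourth_moment_pair:
  assumes j: "j < n" and i: "i < n" and k: "k < n"
  shows "(\<integral>M. M i j ^ 2 * M k j ^ 2 \<partial>H) = (if i = k then 3 else 1) / (real n * (real n + 2))"
proof -
  define \<gamma> where "\<gamma> = (\<integral>M. M i j ^ 4 \<partial>H)"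
  have g4: "(\<integral>M. M a j ^ 4 \<partial>H) = \<gamma>" if "a < n" for a
    using fourth_moment_relations[OF j i that] unfolding \<gamma>_def by (cases "a = i") auto
  have g: "(\<integral>M. M a j ^ 2 * M b j ^ 2 \<partial>H) = (if a = b then \<gamma> else \<gamma> / 3)" if "a < n" "b < n" for a b
    using fourth_moment_relations[OF j that] g4[OF that(1)] by (auto simp flip: power_add)
  have "1 = (\<integral>M. (\<Sum>a<n. \<Sum>b<n. M a j ^ 2 * M b j ^ 2) \<partial>H)"
  proof -
    have "(\<integral>M. (\<Sum>a<n. \<Sum>b<n. M a j ^ 2 * M b j ^ 2) \<partial>H) = (\<integral>M. 1 \<partial>H)"
    proof (intro Bochner_Integration.integral_cong refl)
      fix M assume "M \<in> space H"
      then have "(\<Sum>a<n. M a j ^ 2) = 1"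
        using orth_group_columns[of M n j j] j by (simp add: space_H power2_eq_square)
      then show "(\<Sum>a<n. \<Sum>b<n. M a j ^ 2 * M b j ^ 2) = 1"
        by (simp flip: sum_product)
    qed
    then show ?thesis by (simp add: prob_space)
  qed
  also have "\<dots> = (\<Sum>a<n. \<Sum>b<n. \<integral>M. M a j ^ 2 * M b j ^ 2 \<partial>H)"
    by (simp add: integrable_intros Bochner_Integration.integral_sum)
  also have "\<dots> = (\<Sum>a<n. \<Sum>b<n. (if a = b then 2 * \<gamma> / 3 else 0) + \<gamma> / 3)"
    by (intro sum.cong refl) (auto simp: g)
  also have "\<dots> = real n * (real n + 2) * (\<gamma> / 3)"
    by (simp add: sum.distrib algebra_simps)
  finally have "\<gamma> = 3 / (real n * (real n + 2))"
    using i by (simp add: eq_divide_eq mult_ac)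
  then show ?thesis
    using g[OF i k] by simp
qed

text \<open>The numerator counts the pairings of the four row indices into equal pairs, as in Wick's
  formula. Without such a pairing, flipping the sign of a suitable row makes the integrand
  odd.\<close>

lemma fourth_moment:
  assumes j: "j < n" and "a < n" "b < n" "c < n" "d < n"
  shows "(\<integral>M. (M a j * M b j) * (M c j * M d j) \<partial>H) =
     ((if a = b \<and> c = d then 1 else 0) + (if a = c \<and> b = d then 1 else 0) + (if a = d \<and> b = c then 1 else 0))
       / (real n * (real n + 2))"
proof -
  have odd: "(\<integral>M. (M a j * M b j) * (M c j * M d j) \<partial>H) = 0"
    if "sgn_at {v} a * sgn_at {v} b * (sgn_at {v} c * sgn_at {v} d) = -1" for v
  proof (rule integral_odd_row[where v = v])
    fix M :: "nat \<Rightarrow> nat \<Rightarrow> real"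
    have "sgn_at {v} a * M a j * (sgn_at {v} b * M b j) * (sgn_at {v} c * M c j * (sgn_at {v} d * M d j))
        = (sgn_at {v} a * sgn_at {v} b * (sgn_at {v} c * sgn_at {v} d)) * (M a j * M b j * (M c j * M d j))"
      by (simp add: mult_ac)
    then show "sgn_at {v} a * M a j * (sgn_at {v} b * M b j) * (sgn_at {v} c * M c j * (sgn_at {v} d * M d j))
        = - (M a j * M b j * (M c j * M d j))"
      unfolding that by simp
  qed measurable
  \<comment> \<open>In the case without a pairing, \<open>v\<close> is an index that occurs exactly
    once among \<open>a\<close>, \<open>b\<close>, \<open>c\<close>, \<open>d\<close>.\<close>
  define v where "v = (if a = b then (if c \<noteq> a then c else d) else if a = c \<or> a = d then b else a)"
  consider "a = b" "c = d" | "a = c" "b = d" "a \<noteq> b" | "a = d" "b = c" "a \<noteq> b"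
    | "\<not> (a = b \<and> c = d)" "\<not> (a = c \<and> b = d)" "\<not> (a = d \<and> b = c)"
    by blast
  then show ?thesis
  proof cases
    case 1
    then show ?thesis
      using fourth_moment_pair[OF j, of a c] assms by (auto simp: power2_eq_square)
  next
    case 2
    then show ?thesis
      using fourth_moment_pair[OF j, of a b] assms by (auto simp: power2_eq_square mult_ac)
  next
    case 3
    then show ?thesis
      using fourth_moment_pair[OF j, of a b] assms by (auto simp: power2_eq_square mult_ac)
  next
    case 4
    then have "sgn_at {v} a * sgn_at {v} b * (sgn_at {v} c * sgn_at {v} d) = -1"
      unfolding v_def sgn_at_def by auto
    then have "(\<integral>M. (M a j * M b j) * (M c j * M d j) \<partial>H) = 0"
      by (rule odd)
    then show ?thesis
      unfolding if_not_P[OF 4(1)] if_not_P[OF 4(2)] if_not_P[OF 4(3)] by simp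
  qed
qed

lemma quadratic_form_first_moment:
  assumes j: "j < n"
  shows "(\<integral>M. (\<Sum>i<n. \<Sum>k<n. Q i k * (M i j * M k j)) \<partial>H) = (\<Sum>i<n. Q i i) / real n"
proof -
  have "(\<integral>M. (\<Sum>i<n. \<Sum>k<n. Q i k * (M i j * M k j)) \<partial>H) = (\<Sum>i<n. \<Sum>k<n. Q i k * (\<integral>M. M i j * M k j \<partial>H))"
    by (simp add: integrable_intros Bochner_Integration.integral_sum)
  also have "\<dots> = (\<Sum>i<n. \<Sum>k<n. if k = i then Q i i / real n else 0)"
    using second_moment[OF j] by (intro sum.cong refl) (auto simp: second_moment_offdiag)
  finally show ?thesis
    by (simp add: sum_divide_distrib)
qed

text \<open>The three pairings of the row indices produce the squared trace, the squared
  Hilbert-Schmidt norm and the trace of the square of \<open>Q\<close>; the last two differ in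
  general because \<open>Q\<close> need not be symmetric.\<close>

lemma quadratic_form_second_moment:
  assumes j: "j < n"
  shows "(\<integral>M. (\<Sum>i<n. \<Sum>k<n. Q i k * (M i j * M k j))\<^sup>2 \<partial>H) =
    ((\<Sum>i<n. Q i i)\<^sup>2 + (\<Sum>i<n. \<Sum>k<n. (Q i k)\<^sup>2) + (\<Sum>i<n. \<Sum>k<n. Q i k * Q k i)) / (real n * (real n + 2))"
proof -
  let ?\<beta> = "1 / (real n * (real n + 2))"
  have "(\<integral>M. (\<Sum>i<n. \<Sum>k<n. Q i k * (M i j * M k j))\<^sup>2 \<partial>H)
      = (\<integral>M. (\<Sum>a<n. \<Sum>c<n. \<Sum>b<n. \<Sum>d<n. Q a b * Q c d * ((M a j * M b j) * (M c j * M d j))) \<partial>H)"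
    by (simp add: power2_eq_square sum_product mult_ac)
  also have "\<dots> = (\<Sum>a<n. \<Sum>c<n. \<Sum>b<n. \<Sum>d<n. Q a b * Q c d * (\<integral>M. (M a j * M b j) * (M c j * M d j) \<partial>H))"
    by (simp add: integrable_intros Bochner_Integration.integral_sum)
  also have "\<dots> = (\<Sum>a<n. \<Sum>c<n. \<Sum>b<n. \<Sum>d<n.
       ((if d = c then (if b = a then Q a a * Q c c else 0) else 0)
        + (if d = b then (if c = a then Q a b * Q a b else 0) else 0)
        + (if d = a then (if b = c then Q a c * Q c a else 0) else 0)) * ?\<beta>)"
    by (intro sum.cong refl) (auto simp: fourth_moment[OF j])
  also have "\<dots> = ((\<Sum>a<n. \<Sum>c<n. Q a a * Q c c) + (\<Sum>a<n. \<Sum>b<n. Q a b * Q a b) + (\<Sum>a<n. \<Sum>c<n. Q a c * Q c a)) * ?\<beta>"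
  proof -
    have "(\<Sum>a<n. \<Sum>c<n. \<Sum>b<n. \<Sum>d<n. (if d = c then (if b = a then Q a a * Q c c else 0) else 0)) = (\<Sum>a<n. \<Sum>c<n. Q a a * Q c c)"
      by (intro sum.cong refl) simp
    moreover have "(\<Sum>a<n. \<Sum>c<n. \<Sum>b<n. \<Sum>d<n. (if d = b then (if c = a then Q a b * Q a b else 0) else 0)) = (\<Sum>a<n. \<Sum>b<n. Q a b * Q a b)"
    proof (rule sum.cong[OF refl])
      fix a assume "a \<in> {..<n}"
      have "(\<Sum>c<n. \<Sum>b<n. \<Sum>d<n. (if d = b then (if c = a then Q a b * Q a b else 0) else 0))
         = (\<Sum>c<n. if c = a then (\<Sum>b<n. Q a b * Q a b) else 0)"
        by (intro sum.cong refl) simp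
      then show "(\<Sum>c<n. \<Sum>b<n. \<Sum>d<n. (if d = b then (if c = a then Q a b * Q a b else 0) else 0)) = (\<Sum>b<n. Q a b * Q a b)"
        using \<open>a \<in> {..<n}\<close> by simp
    qed
    moreover have "(\<Sum>a<n. \<Sum>c<n. \<Sum>b<n. \<Sum>d<n. (if d = a then (if b = c then Q a c * Q c a else 0) else 0)) = (\<Sum>a<n. \<Sum>c<n. Q a c * Q c a)"
      by (intro sum.cong refl) simp
    ultimately show ?thesis
      by (simp only: sum.distrib sum_distrib_right[symmetric])
  qed
  also have "(\<Sum>a<n. \<Sum>c<n. Q a a * Q c c) = (\<Sum>i<n. Q i i)\<^sup>2"
    by (simp add: power2_eq_square sum_product)
  finally show ?thesis
    by (simp add: power2_eq_square)
qed

end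

section \<open>The conjugated matrix\<close>

definition conj_entry :: "nat \<Rightarrow> (nat \<Rightarrow> nat \<Rightarrow> real) \<Rightarrow> (nat \<Rightarrow> nat \<Rightarrow> real) \<Rightarrow> nat \<Rightarrow> nat \<Rightarrow> real" where
  "conj_entry n A M j l = (\<Sum>i<n. \<Sum>k<n. A i k * (M i j * M k l))"

text \<open>Column \<open>l\<close> of \<open>perm_mat \<sigma>\<close> has its 1 in row
  \<open>\<sigma> l\<close>, so right multiplication by it replaces column \<open>l\<close> of
  \<open>M\<close> by column \<open>\<sigma> l\<close>.\<close>

lemma trace_conj_perm:
  assumes "\<sigma> permutes {..<n}"
  shows "mat_trace n (mat_mult n (mat_mult n (mat_mult n A M) (perm_mat \<sigma>)) (transp_mat M))
    = (\<Sum>j<n. conj_entry n A M j (\<sigma> j))"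
proof -
  have "(\<Sum>k<n. (\<Sum>a<n. A i a * M a k) * perm_mat \<sigma> k l) * M i l = (\<Sum>a<n. A i a * (M i l * M a (\<sigma> l)))"
    if "l < n" for i l
  proof -
    have "\<sigma> l < n"
      using permutes_in_image[OF assms, of l] that by simp
    have "(\<Sum>k<n. (\<Sum>a<n. A i a * M a k) * perm_mat \<sigma> k l)
       = (\<Sum>k<n. if k = \<sigma> l then (\<Sum>a<n. A i a * M a (\<sigma> l)) else 0)"
      by (intro sum.cong refl) (auto simp: perm_mat_def)
    also have "\<dots> = (\<Sum>a<n. A i a * M a (\<sigma> l))"
      using \<open>\<sigma> l < n\<close> by simp
    finally show ?thesis
      by (simp only: sum_distrib_right) (simp add: mult_ac)
  qed
  then have "mat_trace n (mat_mult n (mat_mult n (mat_mult n A M) (perm_mat \<sigma>)) (transp_mat M))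
    = (\<Sum>i<n. \<Sum>l<n. \<Sum>a<n. A i a * (M i l * M a (\<sigma> l)))"
    unfolding mat_trace_def mat_mult_def transp_mat_def by (intro sum.cong refl) simp
  also have "\<dots> = (\<Sum>j<n. conj_entry n A M j (\<sigma> j))"
    unfolding conj_entry_def by (rule sum.swap)
  finally show ?thesis .
qed

lemma trace_transp_mult_self:
  "mat_trace n (mat_mult n (transp_mat A) A) = (\<Sum>i<n. \<Sum>k<n. (A i k)\<^sup>2)"
  unfolding mat_trace_def mat_mult_def transp_mat_def power2_eq_square by (rule sum.swap)

lemma orth_group_parseval:
  assumes M: "M \<in> orth_group n"
  shows "(\<Sum>l<n. (\<Sum>k<n. v k * M k l)\<^sup>2) = (\<Sum>k<n. (v k)\<^sup>2)"
proof -
  have "(\<Sum>l<n. (\<Sum>k<n. v k * M k l)\<^sup>2) = (\<Sum>l<n. \<Sum>k<n. \<Sum>m<n. v k * v m * (M k l * M m l))"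
    by (simp add: power2_eq_square sum_product mult_ac)
  also have "\<dots> = (\<Sum>k<n. \<Sum>m<n. \<Sum>l<n. v k * v m * (M k l * M m l))"
    by (rule sum_rotate)
  also have "\<dots> = (\<Sum>k<n. \<Sum>m<n. if m = k then (v k)\<^sup>2 else 0)"
    using orth_group_rows[OF M]
    by (intro sum.cong refl) (auto simp: power2_eq_square simp flip: sum_distrib_left)
  finally show ?thesis by simp
qed

text \<open>Row \<open>j\<close> of the conjugated matrix is the vector \<open>A\<^sup>T\<close>
  times column \<open>j\<close> of \<open>M\<close>, rotated by \<open>M\<close>. The rotation drops
  out of the norm, which therefore depends on column \<open>j\<close> alone.\<close>

lemma conj_entry_parseval:
  assumes M: "M \<in> orth_group n"
  shows "(\<Sum>l<n. (conj_entry n A M j l)\<^sup>2) = (\<Sum>k<n. (\<Sum>i<n. A i k * M i j)\<^sup>2)"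
proof -
  have "conj_entry n A M j l = (\<Sum>k<n. (\<Sum>i<n. A i k * M i j) * M k l)" for l
    unfolding conj_entry_def sum_distrib_right by (subst sum.swap) (simp add: mult_ac)
  then show ?thesis
    using orth_group_parseval[OF M] by simp
qed

lemma conj_entry_sum_squares:
  assumes M: "M \<in> orth_group n"
  shows "(\<Sum>j<n. \<Sum>l<n. (conj_entry n A M j l)\<^sup>2) = (\<Sum>i<n. \<Sum>k<n. (A i k)\<^sup>2)"
proof -
  have "(\<Sum>j<n. \<Sum>l<n. (conj_entry n A M j l)\<^sup>2) = (\<Sum>k<n. \<Sum>j<n. (\<Sum>i<n. A i k * M i j)\<^sup>2)"
    unfolding conj_entry_parseval[OF M] by (rule sum.swap)
  also have "\<dots> = (\<Sum>k<n. \<Sum>i<n. (A i k)\<^sup>2)"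
    using orth_group_parseval[OF M] by simp
  also have "\<dots> = (\<Sum>i<n. \<Sum>k<n. (A i k)\<^sup>2)"
    by (rule sum.swap)
  finally show ?thesis .
qed

lemma conj_entry_flip_columns:
  "conj_entry n A (\<lambda>i j. M i j * sgn_at E j) j l = sgn_at E j * sgn_at E l * conj_entry n A M j l"
  unfolding conj_entry_def sum_distrib_left by (intro sum.cong refl) (simp add: mult_ac)

lemma sum_mult_transposed_le:
  fixes A :: "nat \<Rightarrow> nat \<Rightarrow> real"
  shows "(\<Sum>i<n. \<Sum>k<n. A i k * A k i) \<le> (\<Sum>i<n. \<Sum>k<n. (A i k)\<^sup>2)"
proof -
  have "(\<Sum>i<n. \<Sum>k<n. A i k * A k i) \<le> (\<Sum>i<n. \<Sum>k<n. ((A i k)\<^sup>2 + (A k i)\<^sup>2) / 2)"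
  proof (intro sum_mono)
    fix i k
    show "A i k * A k i \<le> ((A i k)\<^sup>2 + (A k i)\<^sup>2) / 2"
      using sum_squares_bound[of "A i k" "A k i"] by simp
  qed
  also have "\<dots> = ((\<Sum>i<n. \<Sum>k<n. (A i k)\<^sup>2) + (\<Sum>i<n. \<Sum>k<n. (A k i)\<^sup>2)) / 2"
    by (simp add: sum.distrib flip: sum_divide_distrib)
  also have "(\<Sum>i<n. \<Sum>k<n. (A k i)\<^sup>2) = (\<Sum>i<n. \<Sum>k<n. (A i k)\<^sup>2)"
    by (rule sum.swap)
  finally show ?thesis by simp
qed

section \<open>Elementary estimates for exponentials and products of cosines\<close>

lemma cmod_iexp_diff_le: "cmod (iexp x - iexp y) \<le> \<bar>x - y\<bar>"
proof -
  have "iexp x - iexp y = iexp y * (iexp (x - y) - 1)"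
    by (simp add: algebra_simps flip: exp_add)
  then have "cmod (iexp x - iexp y) = cmod (iexp (x - y) - 1)"
    by (simp add: norm_mult)
  also have "\<dots> \<le> \<bar>x - y\<bar>"
    using iexp_approx1[of "x - y" 0] by simp
  finally show ?thesis .
qed

lemma abs_exp_minus_diff_le:
  fixes u v :: real
  assumes "0 \<le> u" "0 \<le> v"
  shows "\<bar>exp (- u) - exp (- v)\<bar> \<le> \<bar>u - v\<bar>"
proof -
  have *: "exp (- u) - exp (- v) \<le> v - u" if "0 \<le> u" "u \<le> v" for u v :: real
  proof -
    have "exp (- u) - exp (- v) = exp (- u) * (1 - exp (- (v - u)))"
      by (simp add: algebra_simps flip: exp_add)
    also have "\<dots> \<le> 1 * (v - u)"
      using that exp_ge_add_one_self[of "- (v - u)"] by (intro mult_mono) (simp_all add: algebra_simps)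
    finally show ?thesis by simp
  qed
  show ?thesis
  proof (cases "u \<le> v")
    case True
    then show ?thesis using *[of u v] assms by simp
  next
    case False
    then show ?thesis using *[of v u] assms by simp
  qed
qed

text \<open>All factors have modulus at most 1, so the difference of the products is at most the sum
  of the differences of the factors.\<close>

lemma abs_prod_cos_minus_exp_le:
  fixes x :: "'a \<Rightarrow> real"
  assumes "finite J"
  shows "\<bar>(\<Prod>j\<in>J. cos (x j)) - exp (- (\<Sum>j\<in>J. (x j)\<^sup>2) / 2)\<bar> \<le> (\<Sum>j\<in>J. x j ^ 4)"
proof -
  have "exp (- (\<Sum>j\<in>J. (x j)\<^sup>2) / 2) = (\<Prod>j\<in>J. exp (- (x j)\<^sup>2 / 2))"
    using assms by (simp add: sum_negf sum_divide_distrib flip: exp_sum)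
  then have "\<bar>(\<Prod>j\<in>J. cos (x j)) - exp (- (\<Sum>j\<in>J. (x j)\<^sup>2) / 2)\<bar>
     = norm ((\<Prod>j\<in>J. cos (x j)) - (\<Prod>j\<in>J. exp (- (x j)\<^sup>2 / 2)))"
    by simp
  also have "\<dots> \<le> (\<Sum>j\<in>J. norm (cos (x j) - exp (- (x j)\<^sup>2 / 2)))"
    by (rule norm_prod_diff) auto
  also have "\<dots> \<le> (\<Sum>j\<in>J. x j ^ 4)"
    using abs_cos_minus_exp_le by (intro sum_mono) simp
  finally show ?thesis .
qed

text \<open>The bound on \<open>n\<close> makes \<open>real n - 1\<close>, the number of
  off-diagonal entries in a row, positive. The bound on \<open>s\<close> makes the Gaussian variance
  nonnegative; it is later derived from the normalisation of the trace.\<close>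

locale haar_conj = haar_measure +
  fixes A :: "nat \<Rightarrow> nat \<Rightarrow> real" and s :: real
  assumes norm_A: "(\<Sum>i<n. \<Sum>k<n. (A i k)\<^sup>2) = real n"
    and n_ge_2: "2 \<le> n"
    and s_le_1: "s\<^sup>2 \<le> 1"
begin

abbreviation B :: "nat \<Rightarrow> nat \<Rightarrow> (nat \<Rightarrow> nat \<Rightarrow> real) \<Rightarrow> real" where
  "B j l M \<equiv> conj_entry n A M j l"

lemma bdd_measurable_B: "bdd_measurable H (B j l)"
  unfolding conj_entry_def by (intro bdd_measurable_intros bdd_measurable_entry)

lemmas B_intros = integrable_bdd_measurable bdd_measurable_intros bdd_measurable_B

text \<open>Squared bias plus a variance bound: the diagonal entries have mean trace over
  \<open>n\<close>, and the two non-trace pairings contribute at most \<open>n\<close> each, over a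
  denominator of at least \<open>n\<^sup>2\<close>.\<close>

definition diag_dev :: real where
  "diag_dev = ((\<Sum>i<n. A i i) / real n - s)\<^sup>2 + 2 / real n"

lemma diag_dev_nonneg: "diag_dev \<ge> 0"
  by (simp add: diag_dev_def)

lemma diagonal_second_moment:
  assumes j: "j < n"
  shows "(\<integral>M. (B j j M - s)\<^sup>2 \<partial>H) \<le> diag_dev"
proof -
  define m where "m = (\<Sum>i<n. A i i) / real n"
  have n: "real n > 0"
    using n_ge_2 by simp
  have T: "(\<Sum>i<n. A i i) = real n * m"
    using n by (simp add: m_def)
  have E1: "(\<integral>M. B j j M \<partial>H) = m"
    using quadratic_form_first_moment[OF j, of A] by (simp add: conj_entry_def m_def)
  have "(\<integral>M. (B j j M)\<^sup>2 \<partial>H) = ((real n * m)\<^sup>2 + real n + (\<Sum>i<n. \<Sum>k<n. A i k * A k i)) / (real n * (real n + 2))"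
    using quadratic_form_second_moment[OF j, of A] by (simp add: conj_entry_def norm_A T)
  also have "\<dots> \<le> ((real n * m)\<^sup>2 + real n + real n) / (real n * (real n + 2))"
    using sum_mult_transposed_le[where A = A and n = n] norm_A by (intro divide_right_mono) auto
  also have "\<dots> \<le> ((real n * m)\<^sup>2 + real n + real n) / (real n * real n)"
    using n by (intro divide_left_mono mult_left_mono mult_pos_pos) auto
  also have "\<dots> = m\<^sup>2 + 2 / real n"
    using n by (simp add: field_simps power2_eq_square)
  finally have E2: "(\<integral>M. (B j j M)\<^sup>2 \<partial>H) \<le> m\<^sup>2 + 2 / real n" .
  have "(\<integral>M. (B j j M - s)\<^sup>2 \<partial>H) = (\<integral>M. (B j j M)\<^sup>2 - 2 * s * B j j M + s\<^sup>2 \<partial>H)"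
    by (simp add: power2_diff algebra_simps)
  also have "\<dots> = (\<integral>M. (B j j M)\<^sup>2 \<partial>H) - 2 * s * m + s\<^sup>2"
    by (simp add: B_intros E1 prob_space)
  also have "\<dots> \<le> diag_dev"
    using E2 unfolding diag_dev_def m_def[symmetric] by (simp add: power2_diff)
  finally show ?thesis .
qed

text \<open>The squared row norm is the quadratic form of \<open>A A\<^sup>T\<close> in column
  \<open>j\<close> of \<open>M\<close>. That matrix has trace \<open>n\<close>, and by
  Cauchy-Schwarz its squared Hilbert-Schmidt norm is at most \<open>n\<^sup>2\<close>; so each of
  the three pairings contributes at most 1.\<close>

lemma row_norm_fourth_moment:
  assumes j: "j < n"
  shows "(\<integral>M. (\<Sum>l<n. (B j l M)\<^sup>2)\<^sup>2 \<partial>H) \<le> 3"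
proof -
  define Q where "Q i a = (\<Sum>k<n. A i k * A a k)" for i a
  have n: "real n > 0"
    using n_ge_2 by simp
  have rep: "(\<Sum>l<n. (B j l M)\<^sup>2) = (\<Sum>i<n. \<Sum>a<n. Q i a * (M i j * M a j))" if "M \<in> space H" for M
  proof -
    have "(\<Sum>l<n. (B j l M)\<^sup>2) = (\<Sum>k<n. \<Sum>i<n. \<Sum>a<n. A i k * A a k * (M i j * M a j))"
      using conj_entry_parseval[of M n A j] that
      by (simp add: space_H power2_eq_square sum_product mult_ac)
    also have "\<dots> = (\<Sum>i<n. \<Sum>a<n. \<Sum>k<n. A i k * A a k * (M i j * M a j))"
      by (rule sum_rotate)
    finally show ?thesis
      by (simp add: Q_def sum_distrib_right)
  qed
  have tr: "(\<Sum>i<n. Q i i) = real n"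
    using norm_A by (simp add: Q_def power2_eq_square)
  have "(\<Sum>i<n. \<Sum>a<n. (Q i a)\<^sup>2) \<le> (\<Sum>i<n. \<Sum>a<n. (\<Sum>k<n. (A i k)\<^sup>2) * (\<Sum>k<n. (A a k)\<^sup>2))"
    unfolding Q_def by (intro sum_mono Cauchy_Schwarz_ineq_sum)
  also have "\<dots> = (real n)\<^sup>2"
    by (simp add: norm_A power2_eq_square[of "real n"] flip: sum_product)
  finally have hs: "(\<Sum>i<n. \<Sum>a<n. (Q i a)\<^sup>2) \<le> (real n)\<^sup>2" .
  have "(\<integral>M. (\<Sum>l<n. (B j l M)\<^sup>2)\<^sup>2 \<partial>H) = (\<integral>M. (\<Sum>i<n. \<Sum>a<n. Q i a * (M i j * M a j))\<^sup>2 \<partial>H)"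
    by (intro Bochner_Integration.integral_cong refl) (simp add: rep)
  also have "\<dots> = ((real n)\<^sup>2 + (\<Sum>i<n. \<Sum>a<n. (Q i a)\<^sup>2) + (\<Sum>i<n. \<Sum>a<n. Q i a * Q a i)) / (real n * (real n + 2))"
    using quadratic_form_second_moment[OF j, of Q] by (simp add: tr)
  also have "\<dots> \<le> ((real n)\<^sup>2 + (real n)\<^sup>2 + (real n)\<^sup>2) / (real n * real n)"
    using n hs order_trans[OF sum_mult_transposed_le[where A = Q and n = n] hs]
    by (intro frac_le add_mono mult_left_mono) auto
  also have "\<dots> = 3"
    using n by (simp add: power2_eq_square)
  finally show ?thesis .
qed

text \<open>Since \<open>j\<close> is neither \<open>l\<close> nor \<open>k\<close>, the reflection
  fixes column \<open>j\<close> of \<open>M\<close> and acts only through the second index.\<close>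

lemma B_mult_refl:
  assumes "l < n" "k < n" "l \<noteq> k" "j \<noteq> l" "j \<noteq> k" "j < n"
  shows "B j l (mat_mult n M (refl_mat n l k)) = (B j l M + B j k M) / sqrt 2"
    and "B j k (mat_mult n M (refl_mat n l k)) = (B j l M - B j k M) / sqrt 2"
  using assms unfolding conj_entry_def
  by (simp_all add: mat_mult_refl_mat_right sum.distrib sum_subtractf algebra_simps
      add_divide_distrib diff_divide_distrib sum_divide_distrib)

text \<open>All off-diagonal entries of row \<open>j\<close> share one fourth moment
  \<open>\<gamma>\<close>, and their mixed moments are at least \<open>\<gamma> / 3\<close>. Summed
  over the (n - 1)^2 pairs, these are at most the fourth moment of the row norm, which is at most 3;
  hence the constant 9.\<close>

lemma offdiagonal_fourth_moment:
  assumes j: "j < n" and l: "l < n" and "j \<noteq> l"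
  shows "(\<integral>M. B j l M ^ 4 \<partial>H) \<le> 9 / (real n - 1)\<^sup>2"
proof -
  define \<gamma> where "\<gamma> = (\<integral>M. B j l M ^ 4 \<partial>H)"
  have meas [measurable]: "B a b \<in> borel_measurable H" for a b
    using bdd_measurable_measurable[OF bdd_measurable_B] .
  have \<gamma>: "\<gamma> \<ge> 0"
    unfolding \<gamma>_def by (intro integral_nonneg_AE) auto
  have rel: "(\<integral>M. B j a M ^ 4 \<partial>H) = 3 * (\<integral>M. (B j a M)\<^sup>2 * (B j b M)\<^sup>2 \<partial>H)"
      "(\<integral>M. B j b M ^ 4 \<partial>H) = 3 * (\<integral>M. (B j a M)\<^sup>2 * (B j b M)\<^sup>2 \<partial>H)"
    if ab: "a < n" "b < n" "a \<noteq> b" "j \<noteq> a" "j \<noteq> b" for a b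
  proof -
    have 1: "(\<integral>M. ((B j a M + B j b M) / sqrt 2) ^ 4 \<partial>H) = (\<integral>M. B j a M ^ 4 \<partial>H)"
      using integral_mult_right[OF refl_mat_in_orth_group[OF ab(1-3)], of "\<lambda>M. B j a M ^ 4"] B_mult_refl[OF ab j]
      by simp
    have 2: "(\<integral>M. ((B j a M - B j b M) / sqrt 2) ^ 4 \<partial>H) = (\<integral>M. B j b M ^ 4 \<partial>H)"
      using integral_mult_right[OF refl_mat_in_orth_group[OF ab(1-3)], of "\<lambda>M. B j b M ^ 4"] B_mult_refl[OF ab j]
      by simp
    have 3: "(\<integral>M. B j a M ^ 3 * B j b M \<partial>H) = 0"
      by (rule integral_odd_column[where v = b])
        (measurable, use ab in \<open>simp only: conj_entry_flip_columns, simp add: sgn_at_def\<close>)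
    have 4: "(\<integral>M. B j a M * B j b M ^ 3 \<partial>H) = 0"
      by (rule integral_odd_column[where v = a])
        (measurable, use ab in \<open>simp only: conj_entry_flip_columns, simp add: sgn_at_def\<close>)
    show "(\<integral>M. B j a M ^ 4 \<partial>H) = 3 * (\<integral>M. (B j a M)\<^sup>2 * (B j b M)\<^sup>2 \<partial>H)"
      "(\<integral>M. B j b M ^ 4 \<partial>H) = 3 * (\<integral>M. (B j a M)\<^sup>2 * (B j b M)\<^sup>2 \<partial>H)"
      using fourth_moments_45_degrees[OF bdd_measurable_B bdd_measurable_B 1 2 3 4] by blast+
  qed
  have g4: "(\<integral>M. B j a M ^ 4 \<partial>H) = \<gamma>" if "a < n" "j \<noteq> a" for a
    using rel[of l a] that l \<open>j \<noteq> l\<close> unfolding \<gamma>_def by (cases "a = l") auto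
  have g: "\<gamma> / 3 \<le> (\<integral>M. (B j a M)\<^sup>2 * (B j b M)\<^sup>2 \<partial>H)" if "a \<in> {..<n} - {j}" "b \<in> {..<n} - {j}" for a b
    using rel[of a b] g4[of a] that \<gamma> by (cases "a = b") (auto simp flip: power_add)
  have "(real n - 1)\<^sup>2 * (\<gamma> / 3) = (\<Sum>a\<in>{..<n} - {j}. \<Sum>b\<in>{..<n} - {j}. \<gamma> / 3)"
    using j by (simp add: power2_eq_square of_nat_diff)
  also have "\<dots> \<le> (\<Sum>a\<in>{..<n} - {j}. \<Sum>b\<in>{..<n} - {j}. \<integral>M. (B j a M)\<^sup>2 * (B j b M)\<^sup>2 \<partial>H)"
    by (intro sum_mono g)
  also have "\<dots> = (\<integral>M. (\<Sum>a\<in>{..<n} - {j}. (B j a M)\<^sup>2)\<^sup>2 \<partial>H)"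
    by (simp add: B_intros Bochner_Integration.integral_sum power2_eq_square[of "sum _ _"] sum_product)
  also have "\<dots> \<le> (\<integral>M. (\<Sum>a<n. (B j a M)\<^sup>2)\<^sup>2 \<partial>H)"
    by (intro integral_mono power_mono sum_mono2 sum_nonneg) (auto intro!: B_intros)
  also have "\<dots> \<le> 3"
    by (rule row_norm_fourth_moment[OF j])
  finally show ?thesis
    using n_ge_2 unfolding \<gamma>_def by (simp add: field_simps)
qed

lemma offdiagonal_second_moment:
  assumes "j < n" "l < n" "j \<noteq> l"
  shows "(\<integral>M. (B j l M)\<^sup>2 \<partial>H) \<le> 3 / (real n - 1)"
proof -
  have "(\<integral>M. (B j l M)\<^sup>2 \<partial>H)\<^sup>2 \<le> (\<integral>M. ((B j l M)\<^sup>2)\<^sup>2 \<partial>H)"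
    by (intro square_expectation_le bdd_measurable_intros bdd_measurable_B)
  also have "\<dots> \<le> (3 / (real n - 1))\<^sup>2"
    using offdiagonal_fourth_moment[OF assms] by (simp add: power_divide flip: power_mult)
  finally show ?thesis
    by (rule power2_le_imp_le) (use n_ge_2 in auto)
qed

lemma offdiagonal_abs_moment:
  assumes "j < n" "l < n" "j \<noteq> l"
  shows "(\<integral>M. \<bar>B j l M\<bar> \<partial>H) \<le> sqrt (3 / (real n - 1))"
  by (intro expectation_abs_le_sqrt bdd_measurable_B offdiagonal_second_moment assms)

end

section \<open>Conditioning on the permutation\<close>

context haar_conj
begin

text \<open>None of the \<open>2 ^ n\<close> column sign changes alters the integral, so the
  integrand may be replaced by its average over them, and that average is a product of
  cosines.\<close>

lemma expectation_iexp_eq_prod_cos: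
  assumes \<sigma>: "\<sigma> permutes {..<n}"
  defines "J \<equiv> {..<n} - cycle_minima n \<sigma>"
  shows "(\<integral>M. iexp (\<Sum>j\<in>J. t * B j (\<sigma> j) M) \<partial>H) = of_real (\<integral>M. (\<Prod>j\<in>J. cos (t * B j (\<sigma> j) M)) \<partial>H)"
proof -
  let ?g = "\<lambda>M. iexp (\<Sum>j\<in>J. t * B j (\<sigma> j) M)"
  let ?h = "\<lambda>E M. iexp (\<Sum>j\<in>J. sgn_at E j * sgn_at E (\<sigma> j) * (t * B j (\<sigma> j) M))"
  have inv: "(\<integral>M. ?h E M \<partial>H) = (\<integral>M. ?g M \<partial>H)" for E
  proof -
    have "(\<integral>M. ?g (\<lambda>i j. M i j * sgn_at E j) \<partial>H) = (\<integral>M. ?g M \<partial>H)"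
      by (rule integral_flip_columns)
        (intro bdd_measurable_measurable bdd_measurable_intros bdd_measurable_B)
    then show ?thesis
      unfolding conj_entry_flip_columns by (simp only: mult.left_commute[of t])
  qed
  have "2 ^ n * (\<integral>M. ?g M \<partial>H) = (\<Sum>E\<in>Pow {..<n}. \<integral>M. ?h E M \<partial>H)"
    unfolding inv by (simp add: card_Pow)
  also have "\<dots> = (\<integral>M. (\<Sum>E\<in>Pow {..<n}. ?h E M) \<partial>H)"
    by (rule Bochner_Integration.integral_sum[symmetric])
      (intro integrable_bdd_measurable bdd_measurable_intros bdd_measurable_B)
  also have "\<dots> = (\<integral>M. 2 ^ n * complex_of_real (\<Prod>j\<in>J. cos (t * B j (\<sigma> j) M)) \<partial>H)"
    unfolding J_def by (subst sum_iexp_signs[OF \<sigma>]) simp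
  also have "\<dots> = 2 ^ n * complex_of_real (\<integral>M. (\<Prod>j\<in>J. cos (t * B j (\<sigma> j) M)) \<partial>H)"
    by (simp del: of_real_prod)
  finally show ?thesis by simp
qed

text \<open>This stands in for the conditional variance. Summing over all moved points, not just
  those outside \<open>cycle_minima\<close>, gives it the shape of a sum of
  \<open>c j (\<sigma> j)\<close>, to which the permutation averages apply; the surplus terms are
  paid for in the next bound.\<close>

definition moved_sum :: "(nat \<Rightarrow> nat) \<Rightarrow> (nat \<Rightarrow> nat \<Rightarrow> real) \<Rightarrow> real" where
  "moved_sum \<sigma> M = (\<Sum>j<n. if j = \<sigma> j then 0 else (B j (\<sigma> j) M)\<^sup>2)"

lemma bdd_measurable_moved_sum: "bdd_measurable H (moved_sum \<sigma>)"
proof -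
  have "bdd_measurable H (\<lambda>M. if j = \<sigma> j then 0 else (B j (\<sigma> j) M)\<^sup>2)" for j
    by (cases "j = \<sigma> j") (simp_all add: bdd_measurable_intros bdd_measurable_B)
  then show ?thesis
    unfolding moved_sum_def by (intro bdd_measurable_sum)
qed

text \<open>The first error replaces diagonal entries at fixed points by \<open>s\<close> and drops
  the moved cycle minima; the second turns cosines into Gaussian factors; the third replaces the
  conditional variance by \<open>1 - s\<^sup>2\<close>. All are linear in the two cardinalities,
  ready for averaging over \<open>\<sigma>\<close>.\<close>

lemma conditional_char_bound:
  assumes \<sigma>: "\<sigma> permutes {..<n}"
  shows "cmod ((\<integral>M. iexp (t * (\<Sum>j<n. B j (\<sigma> j) M)) \<partial>H)
           - iexp (t * s) ^ card (fixed_points n \<sigma>) * of_real (exp (- (t\<^sup>2 * (1 - s\<^sup>2) / 2))))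
     \<le> \<bar>t\<bar> * (card (fixed_points n \<sigma>) * sqrt diag_dev + card (cycle_minima n \<sigma>) * sqrt (3 / (real n - 1)))
       + t ^ 4 * (9 * real n / (real n - 1)\<^sup>2)
       + t\<^sup>2 / 2 * ((\<integral>M. \<bar>moved_sum \<sigma> M - (1 - s\<^sup>2)\<bar> \<partial>H) + card (cycle_minima n \<sigma>) * (3 / (real n - 1)))"
proof -
  define F where "F = fixed_points n \<sigma>"
  define T where "T = cycle_minima n \<sigma>"
  define J where "J = {..<n} - T"
  define a where "a = 1 - s\<^sup>2"
  define b where "b j = B j (\<sigma> j)" for j
  define L where "L = iexp (t * s) ^ card F"
  have "a \<ge> 0"
    using s_le_1 by (simp add: a_def)
  have fin [simp]: "finite F" "finite T" "finite J" "finite (T - F)"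
    by (simp_all add: F_def T_def J_def)
  have FT: "F \<subseteq> T" "T \<subseteq> {..<n}"
    using fixed_points_subset cycle_minima_subset by (simp_all add: F_def T_def)
  have [simp]: "cmod L = 1"
    by (simp add: L_def norm_power)
  have \<sigma>n: "\<sigma> j < n" if "j < n" for j
    using permutes_in_image[OF \<sigma>, of j] that by simp
  have moved: "\<sigma> j < n" "j < n" "j \<noteq> \<sigma> j" if "j \<in> J \<or> j \<in> T - F" for j
    using that FT \<sigma>n[of j] unfolding J_def F_def fixed_points_def by auto
  have bm: "bdd_measurable H (b j)" for j
    unfolding b_def by (rule bdd_measurable_B)
  note bi = integrable_bdd_measurable bdd_measurable_intros bm bdd_measurable_B bdd_measurable_moved_sum
  \<comment> \<open>Three groups of indices: fixed points, moved cycle minima, and the rest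
    \<open>J\<close>, on which the signs are independent.\<close>
  have split: "(\<Sum>j<n. f j) = (\<Sum>j\<in>F. f j) + (\<Sum>j\<in>T - F. f j) + (\<Sum>j\<in>J. f j)" for f :: "nat \<Rightarrow> real"
    using FT sum.subset_diff[of F T f] sum.subset_diff[of T "{..<n}" f] by (simp add: J_def add_ac)

  \<comment> \<open>\<open>L\<close> is what the fixed points contribute once each diagonal entry is
    replaced by \<open>s\<close>; the estimate is the Lipschitz bound for
    \<open>iexp\<close>.\<close>
  have step1: "cmod ((\<integral>M. iexp (t * (\<Sum>j<n. b j M)) \<partial>H) - (\<integral>M. L * iexp (\<Sum>j\<in>J. t * b j M) \<partial>H))
      \<le> \<bar>t\<bar> * (card F * sqrt diag_dev + card T * sqrt (3 / (real n - 1)))"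
  proof -
    have "cmod ((\<integral>M. iexp (t * (\<Sum>j<n. b j M)) \<partial>H) - (\<integral>M. L * iexp (\<Sum>j\<in>J. t * b j M) \<partial>H))
       = cmod (\<integral>M. iexp (t * (\<Sum>j<n. b j M)) - L * iexp (\<Sum>j\<in>J. t * b j M) \<partial>H)"
      by (subst Bochner_Integration.integral_diff) (intro bi refl)+
    also have "\<dots> \<le> (\<integral>M. cmod (iexp (t * (\<Sum>j<n. b j M)) - L * iexp (\<Sum>j\<in>J. t * b j M)) \<partial>H)"
      by (rule integral_norm_bound)
    also have "\<dots> \<le> (\<integral>M. \<bar>t\<bar> * ((\<Sum>j\<in>F. \<bar>B j j M - s\<bar>) + (\<Sum>j\<in>T - F. \<bar>b j M\<bar>)) \<partial>H)"
    proof (rule integral_mono)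
      fix M
      have "L * iexp (\<Sum>j\<in>J. t * b j M) = iexp (t * s * card F + (\<Sum>j\<in>J. t * b j M))"
        unfolding L_def exp_of_nat_mult[symmetric] exp_add[symmetric] by (simp add: algebra_simps)
      then have "cmod (iexp (t * (\<Sum>j<n. b j M)) - L * iexp (\<Sum>j\<in>J. t * b j M))
          \<le> \<bar>t * (\<Sum>j<n. b j M) - (t * s * card F + (\<Sum>j\<in>J. t * b j M))\<bar>"
        by (simp only: cmod_iexp_diff_le)
      also have "t * (\<Sum>j<n. b j M) - (t * s * card F + (\<Sum>j\<in>J. t * b j M))
          = t * ((\<Sum>j\<in>F. B j j M - s) + (\<Sum>j\<in>T - F. b j M))"
      proof -
        have "(\<Sum>j\<in>F. b j M) = (\<Sum>j\<in>F. B j j M)"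
          by (intro sum.cong refl) (auto simp: F_def fixed_points_def b_def)
        then show ?thesis
          unfolding split by (simp add: sum_subtractf algebra_simps flip: sum_distrib_left)
      qed
      also have "\<bar>\<dots>\<bar> \<le> \<bar>t\<bar> * ((\<Sum>j\<in>F. \<bar>B j j M - s\<bar>) + (\<Sum>j\<in>T - F. \<bar>b j M\<bar>))"
        unfolding abs_mult by (intro mult_left_mono order_trans[OF abs_triangle_ineq] add_mono sum_abs) auto
      finally show "cmod (iexp (t * (\<Sum>j<n. b j M)) - L * iexp (\<Sum>j\<in>J. t * b j M))
         \<le> \<bar>t\<bar> * ((\<Sum>j\<in>F. \<bar>B j j M - s\<bar>) + (\<Sum>j\<in>T - F. \<bar>b j M\<bar>))" .
    qed (intro bi)+
    also have "\<dots> = \<bar>t\<bar> * ((\<Sum>j\<in>F. \<integral>M. \<bar>B j j M - s\<bar> \<partial>H) + (\<Sum>j\<in>T - F. \<integral>M. \<bar>b j M\<bar> \<partial>H))"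
      by (simp add: bi Bochner_Integration.integral_sum)
    also have "\<dots> \<le> \<bar>t\<bar> * ((\<Sum>j\<in>F. sqrt diag_dev) + (\<Sum>j\<in>T - F. sqrt (3 / (real n - 1))))"
    proof (intro mult_left_mono add_mono sum_mono)
      show "(\<integral>M. \<bar>B j j M - s\<bar> \<partial>H) \<le> sqrt diag_dev" if "j \<in> F" for j
        using that FT by (intro expectation_abs_le_sqrt diagonal_second_moment bi) auto
      show "(\<integral>M. \<bar>b j M\<bar> \<partial>H) \<le> sqrt (3 / (real n - 1))" if "j \<in> T - F" for j
        using moved[of j] that unfolding b_def by (intro offdiagonal_abs_moment) auto
    qed auto
    also have "\<dots> \<le> \<bar>t\<bar> * (card F * sqrt diag_dev + card T * sqrt (3 / (real n - 1)))"
    proof (intro mult_left_mono add_mono)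
      have "real (card (T - F)) \<le> real (card T)"
        by (simp add: card_mono)
      then show "(\<Sum>j\<in>T - F. sqrt (3 / (real n - 1))) \<le> card T * sqrt (3 / (real n - 1))"
        unfolding sum_constant using n_ge_2 by (intro mult_right_mono) auto
    qed auto
    finally show ?thesis .
  qed

  have step2: "(\<integral>M. L * iexp (\<Sum>j\<in>J. t * b j M) \<partial>H) = L * of_real (\<integral>M. (\<Prod>j\<in>J. cos (t * b j M)) \<partial>H)"
    using expectation_iexp_eq_prod_cos[OF \<sigma>, of t] unfolding J_def T_def b_def by simp

  \<comment> \<open>The intermediate quantity is the exponential of minus half the sum of
    \<open>(t * b j M)\<^sup>2\<close> over \<open>J\<close>; passing from \<open>J\<close> to
    \<open>moved_sum\<close> costs the squares over \<open>T - F\<close>.\<close>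
  have step3: "\<bar>(\<integral>M. (\<Prod>j\<in>J. cos (t * b j M)) \<partial>H) - exp (- (t\<^sup>2 * a / 2))\<bar>
     \<le> t ^ 4 * (9 * real n / (real n - 1)\<^sup>2)
       + t\<^sup>2 / 2 * ((\<integral>M. \<bar>moved_sum \<sigma> M - a\<bar> \<partial>H) + card T * (3 / (real n - 1)))"
  proof -
    have "\<bar>(\<integral>M. (\<Prod>j\<in>J. cos (t * b j M)) \<partial>H) - exp (- (t\<^sup>2 * a / 2))\<bar>
      = \<bar>\<integral>M. (\<Prod>j\<in>J. cos (t * b j M)) - exp (- (t\<^sup>2 * a / 2)) \<partial>H\<bar>"
      by (simp add: bi prob_space)
    also have "\<dots> \<le> (\<integral>M. \<bar>(\<Prod>j\<in>J. cos (t * b j M)) - exp (- (t\<^sup>2 * a / 2))\<bar> \<partial>H)"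
      by (rule integral_abs_bound)
    also have "\<dots> \<le> (\<integral>M. t ^ 4 * (\<Sum>j\<in>J. b j M ^ 4) +
         t\<^sup>2 / 2 * (\<bar>moved_sum \<sigma> M - a\<bar> + (\<Sum>j\<in>T - F. (b j M)\<^sup>2)) \<partial>H)"
    proof (rule integral_mono)
      fix M
      have X: "moved_sum \<sigma> M = (\<Sum>j\<in>T - F. (b j M)\<^sup>2) + (\<Sum>j\<in>J. (b j M)\<^sup>2)"
      proof -
        have "(\<Sum>j\<in>F. if j = \<sigma> j then 0 else (B j (\<sigma> j) M)\<^sup>2) = 0"
          by (intro sum.neutral) (auto simp: F_def fixed_points_def)
        moreover have "(\<Sum>j\<in>T - F. if j = \<sigma> j then 0 else (B j (\<sigma> j) M)\<^sup>2) = (\<Sum>j\<in>T - F. (b j M)\<^sup>2)"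
          using moved by (intro sum.cong refl) (auto simp: b_def)
        moreover have "(\<Sum>j\<in>J. if j = \<sigma> j then 0 else (B j (\<sigma> j) M)\<^sup>2) = (\<Sum>j\<in>J. (b j M)\<^sup>2)"
          using moved by (intro sum.cong refl) (auto simp: b_def)
        ultimately show ?thesis
          unfolding moved_sum_def split by simp
      qed
      have "\<bar>(\<Prod>j\<in>J. cos (t * b j M)) - exp (- ((\<Sum>j\<in>J. (t * b j M)\<^sup>2) / 2))\<bar> \<le> (\<Sum>j\<in>J. (t * b j M) ^ 4)"
        using abs_prod_cos_minus_exp_le[of J "\<lambda>j. t * b j M"] by simp
      moreover have "\<bar>exp (- ((\<Sum>j\<in>J. (t * b j M)\<^sup>2) / 2)) - exp (- (t\<^sup>2 * a / 2))\<bar>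
         \<le> \<bar>(\<Sum>j\<in>J. (t * b j M)\<^sup>2) / 2 - t\<^sup>2 * a / 2\<bar>"
        using \<open>a \<ge> 0\<close> by (intro abs_exp_minus_diff_le) (auto intro!: divide_nonneg_nonneg sum_nonneg)
      moreover have "(\<Sum>j\<in>J. (t * b j M)\<^sup>2) / 2 - t\<^sup>2 * a / 2 = t\<^sup>2 / 2 * ((\<Sum>j\<in>J. (b j M)\<^sup>2) - a)"
        by (simp add: power_mult_distrib algebra_simps diff_divide_distrib flip: sum_distrib_left)
      moreover have "\<bar>t\<^sup>2 / 2 * ((\<Sum>j\<in>J. (b j M)\<^sup>2) - a)\<bar>
         \<le> t\<^sup>2 / 2 * (\<bar>moved_sum \<sigma> M - a\<bar> + (\<Sum>j\<in>T - F. (b j M)\<^sup>2))"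
      proof -
        have "(\<Sum>j\<in>T - F. (b j M)\<^sup>2) \<ge> 0"
          by (intro sum_nonneg) auto
        then have "\<bar>(\<Sum>j\<in>J. (b j M)\<^sup>2) - a\<bar> \<le> \<bar>moved_sum \<sigma> M - a\<bar> + (\<Sum>j\<in>T - F. (b j M)\<^sup>2)"
          unfolding X by linarith
        then show ?thesis
          unfolding abs_mult by (intro mult_mono) auto
      qed
      moreover have "(\<Sum>j\<in>J. (t * b j M) ^ 4) = t ^ 4 * (\<Sum>j\<in>J. b j M ^ 4)"
        by (simp add: power_mult_distrib sum_distrib_left)
      ultimately show "\<bar>(\<Prod>j\<in>J. cos (t * b j M)) - exp (- (t\<^sup>2 * a / 2))\<bar>
         \<le> t ^ 4 * (\<Sum>j\<in>J. b j M ^ 4) + t\<^sup>2 / 2 * (\<bar>moved_sum \<sigma> M - a\<bar> + (\<Sum>j\<in>T - F. (b j M)\<^sup>2))"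
        by linarith
    qed (intro bi)+
    also have "\<dots> = t ^ 4 * (\<Sum>j\<in>J. \<integral>M. b j M ^ 4 \<partial>H) +
       t\<^sup>2 / 2 * ((\<integral>M. \<bar>moved_sum \<sigma> M - a\<bar> \<partial>H) + (\<Sum>j\<in>T - F. \<integral>M. (b j M)\<^sup>2 \<partial>H))"
      by (simp add: bi Bochner_Integration.integral_sum)
    also have "\<dots> \<le> t ^ 4 * (9 * real n / (real n - 1)\<^sup>2)
       + t\<^sup>2 / 2 * ((\<integral>M. \<bar>moved_sum \<sigma> M - a\<bar> \<partial>H) + card T * (3 / (real n - 1)))"
    proof (intro add_mono mult_left_mono order_refl)
      have "(\<Sum>j\<in>J. \<integral>M. b j M ^ 4 \<partial>H) \<le> (\<Sum>j\<in>J. 9 / (real n - 1)\<^sup>2)"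
        using moved unfolding b_def by (intro sum_mono offdiagonal_fourth_moment) auto
      also have "\<dots> \<le> real n * (9 / (real n - 1)\<^sup>2)"
      proof -
        have "card J \<le> n"
          using card_mono[of "{..<n}" J] by (simp add: J_def)
        then show ?thesis
          unfolding sum_constant by (intro mult_right_mono) auto
      qed
      finally show "(\<Sum>j\<in>J. \<integral>M. b j M ^ 4 \<partial>H) \<le> 9 * real n / (real n - 1)\<^sup>2"
        by (simp add: mult.commute)
      have "(\<Sum>j\<in>T - F. \<integral>M. (b j M)\<^sup>2 \<partial>H) \<le> (\<Sum>j\<in>T - F. 3 / (real n - 1))"
        using moved unfolding b_def by (intro sum_mono offdiagonal_second_moment) auto
      also have "\<dots> \<le> card T * (3 / (real n - 1))"
      proof -
        have "real (card (T - F)) \<le> real (card T)"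
          by (simp add: card_mono)
        then show ?thesis
          unfolding sum_constant using n_ge_2 by (intro mult_right_mono) auto
      qed
      finally show "(\<Sum>j\<in>T - F. \<integral>M. (b j M)\<^sup>2 \<partial>H) \<le> card T * (3 / (real n - 1))" .
    qed auto
    finally show ?thesis .
  qed

  have "cmod ((\<integral>M. iexp (t * (\<Sum>j<n. b j M)) \<partial>H) - L * of_real (exp (- (t\<^sup>2 * a / 2))))
    \<le> cmod ((\<integral>M. iexp (t * (\<Sum>j<n. b j M)) \<partial>H) - (\<integral>M. L * iexp (\<Sum>j\<in>J. t * b j M) \<partial>H))
     + cmod ((\<integral>M. L * iexp (\<Sum>j\<in>J. t * b j M) \<partial>H) - L * of_real (exp (- (t\<^sup>2 * a / 2))))"
    by (rule norm_diff_triangle_le[OF order_refl order_refl])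
  also have "cmod ((\<integral>M. L * iexp (\<Sum>j\<in>J. t * b j M) \<partial>H) - L * of_real (exp (- (t\<^sup>2 * a / 2))))
     = \<bar>(\<integral>M. (\<Prod>j\<in>J. cos (t * b j M)) \<partial>H) - exp (- (t\<^sup>2 * a / 2))\<bar>"
    unfolding step2 right_diff_distrib[symmetric] of_real_diff[symmetric] norm_mult norm_of_real by simp
  finally show ?thesis
    using step1 step3 unfolding b_def L_def a_def F_def T_def by linarith
qed

text \<open>This bounds the mean square deviation of \<open>moved_sum\<close> over both
  \<open>\<sigma>\<close> and \<open>M\<close>. The terms come from fourth powers of off-diagonal
  entries, from sampling without replacement, and from the averaged squared diagonal deviating from
  \<open>s\<^sup>2\<close>.\<close>

definition avg_dev :: real where
  "avg_dev = 9 * real n / (real n - 1)\<^sup>2 + 1 / (real n - 1) + diag_dev + 2 * sqrt diag_dev"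

lemma avg_dev_pos: "avg_dev > 0"
  unfolding avg_dev_def using n_ge_2 diag_dev_nonneg
  by (intro add_pos_nonneg add_nonneg_pos) auto

text \<open>For fixed \<open>M\<close> the mean over \<open>\<sigma>\<close> is exactly
  \<open>1 - q\<close>, with \<open>q\<close> the mean squared diagonal entry, because conjugation
  preserves the Hilbert-Schmidt norm. What remains is the variance over \<open>\<sigma>\<close> and
  the distance of \<open>q\<close> from \<open>s\<^sup>2\<close>.\<close>

lemma sum_moved_sum_deviation:
  assumes M: "M \<in> orth_group n"
  shows "(\<Sum>\<sigma> | \<sigma> permutes {..<n}. (moved_sum \<sigma> M - (1 - s\<^sup>2))\<^sup>2) / fact n
    \<le> (\<Sum>j<n. \<Sum>l\<in>{..<n} - {j}. B j l M ^ 4) / real n + 1 / (real n - 1)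
      + (\<Sum>j<n. (B j j M - s)\<^sup>2 + 2 * \<bar>B j j M - s\<bar>) / real n"
proof -
  define a where "a = 1 - s\<^sup>2"
  define c where "c j l = (if j = l then 0 else (B j l M)\<^sup>2)" for j l
  define S where "S = (\<Sum>j<n. \<Sum>l<n. c j l)"
  define C where "C = (\<Sum>j<n. \<Sum>l<n. (c j l)\<^sup>2)"
  define q where "q = (\<Sum>j<n. (B j j M)\<^sup>2) / real n"
  define r where "r = S / real n"
  have n: "real n > 1"
    using n_ge_2 by simp
  have f1: "fact n = real n * fact (n - 1)"
    using n_ge_2 by (simp add: fact_reduce)
  have f2: "fact n = real n * (real n - 1) * fact (n - 2)"
    using n_ge_2 f1 fact_reduce[of "n - 1", where 'a = real] by (simp add: of_nat_diff numeral_2_eq_2)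
  have cnn: "c j l \<ge> 0" for j l
    by (simp add: c_def)
  have ms: "moved_sum \<sigma> M = (\<Sum>j<n. c j (\<sigma> j))" for \<sigma>
    by (simp add: moved_sum_def c_def)
  have "S = (\<Sum>j<n. \<Sum>l<n. (B j l M)\<^sup>2 - (if l = j then (B j j M)\<^sup>2 else 0))"
    unfolding S_def c_def by (intro sum.cong refl) auto
  also have "\<dots> = real n - real n * q"
    using conj_entry_sum_squares[OF M, of A] norm_A n by (simp add: sum_subtractf q_def)
  finally have r: "r = 1 - q"
    using n by (simp add: r_def field_simps)
  have "r \<ge> 0"
    unfolding r_def S_def using n cnn by (auto intro!: divide_nonneg_nonneg sum_nonneg)
  have "q \<ge> 0"
    unfolding q_def using n by (auto intro!: divide_nonneg_nonneg sum_nonneg)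
  have Ceq: "C = (\<Sum>j<n. \<Sum>l\<in>{..<n} - {j}. B j l M ^ 4)"
  proof -
    have "(\<Sum>l<n. (c j l)\<^sup>2) = (\<Sum>l\<in>{..<n} - {j}. B j l M ^ 4)" for j
      by (intro sum.mono_neutral_cong_right) (auto simp: c_def simp flip: power_mult)
    then show ?thesis by (simp add: C_def)
  qed
  have X1: "(\<Sum>\<sigma> | \<sigma> permutes {..<n}. moved_sum \<sigma> M) = fact n * r"
    unfolding ms sum_permutes_diagonal using n by (simp add: r_def f1 S_def)
  have X2: "(\<Sum>\<sigma> | \<sigma> permutes {..<n}. (moved_sum \<sigma> M)\<^sup>2) \<le> fact n * (C / real n + r\<^sup>2 * real n / (real n - 1))"
  proof -
    have "(\<Sum>\<sigma> | \<sigma> permutes {..<n}. (moved_sum \<sigma> M)\<^sup>2) \<le> fact (n - 1) * C + fact (n - 2) * S\<^sup>2"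
      unfolding ms C_def S_def by (rule sum_permutes_diagonal_square_le) (rule cnn)
    also have "fact (n - 1) * C = fact n * (C / real n)"
      using n by (simp add: f1)
    also have "fact (n - 2) * S\<^sup>2 = fact n * (r\<^sup>2 * real n / (real n - 1))"
      unfolding f2 r_def using n by (simp add: power2_eq_square)
    finally show ?thesis by (simp add: algebra_simps)
  qed
  have "(\<Sum>\<sigma> | \<sigma> permutes {..<n}. (moved_sum \<sigma> M - a)\<^sup>2)
     = (\<Sum>\<sigma> | \<sigma> permutes {..<n}. (moved_sum \<sigma> M)\<^sup>2) - 2 * a * (\<Sum>\<sigma> | \<sigma> permutes {..<n}. moved_sum \<sigma> M) + fact n * a\<^sup>2"
    by (simp add: power2_diff sum.distrib sum_subtractf card_permutations sum_distrib_left mult_ac)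
  also have "\<dots> \<le> fact n * (C / real n + r\<^sup>2 * real n / (real n - 1) - 2 * a * r + a\<^sup>2)"
    using X2 unfolding X1 by (simp add: algebra_simps)
  finally have "(\<Sum>\<sigma> | \<sigma> permutes {..<n}. (moved_sum \<sigma> M - a)\<^sup>2) / fact n
     \<le> C / real n + r\<^sup>2 * real n / (real n - 1) - 2 * a * r + a\<^sup>2"
    by (simp add: divide_le_eq mult.commute)
  also have "r\<^sup>2 * real n / (real n - 1) = r\<^sup>2 + r\<^sup>2 / (real n - 1)"
    using n by (simp add: field_simps)
  also have "r\<^sup>2 / (real n - 1) \<le> 1 / (real n - 1)"
    using n \<open>r \<ge> 0\<close> \<open>q \<ge> 0\<close> r by (intro divide_right_mono) (auto simp: abs_square_le_1)
  finally have "(\<Sum>\<sigma> | \<sigma> permutes {..<n}. (moved_sum \<sigma> M - a)\<^sup>2) / fact n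
     \<le> C / real n + 1 / (real n - 1) + (r - a)\<^sup>2"
    by (simp add: power2_diff algebra_simps)
  also have "(r - a)\<^sup>2 \<le> (\<Sum>j<n. (B j j M - s)\<^sup>2 + 2 * \<bar>B j j M - s\<bar>) / real n"
  proof -
    have ra: "r - a = s\<^sup>2 - q"
      by (simp add: r a_def)
    \<comment> \<open>Both numbers lie between 0 and 1. The square may thus be replaced by the
      absolute value, so that second moments of the diagonal entries suffice.\<close>
    have "\<bar>s\<^sup>2 - q\<bar> \<le> 1"
      using s_le_1 \<open>r \<ge> 0\<close> \<open>q \<ge> 0\<close> r zero_le_power2[of s] by linarith
    then have "(s\<^sup>2 - q)\<^sup>2 \<le> \<bar>s\<^sup>2 - q\<bar>"
      using mult_left_le[of "\<bar>s\<^sup>2 - q\<bar>" "\<bar>s\<^sup>2 - q\<bar>"] by (simp add: power2_eq_square flip: abs_mult)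
    also have "\<bar>s\<^sup>2 - q\<bar> = \<bar>(\<Sum>j<n. s\<^sup>2 - (B j j M)\<^sup>2) / real n\<bar>"
      using n by (simp add: q_def sum_subtractf diff_divide_distrib)
    also have "\<dots> \<le> (\<Sum>j<n. \<bar>s\<^sup>2 - (B j j M)\<^sup>2\<bar>) / real n"
      using n by (simp add: divide_right_mono sum_abs)
    also have "\<dots> \<le> (\<Sum>j<n. (B j j M - s)\<^sup>2 + 2 * \<bar>B j j M - s\<bar>) / real n"
    proof (intro divide_right_mono sum_mono)
      fix j
      have "s\<^sup>2 - (B j j M)\<^sup>2 = - ((B j j M - s)\<^sup>2 + 2 * s * (B j j M - s))"
        by (simp add: power2_eq_square algebra_simps)
      then have "\<bar>s\<^sup>2 - (B j j M)\<^sup>2\<bar> \<le> (B j j M - s)\<^sup>2 + \<bar>2 * s * (B j j M - s)\<bar>"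
        using abs_triangle_ineq[of "(B j j M - s)\<^sup>2" "2 * s * (B j j M - s)"] by simp
      also have "\<bar>2 * s * (B j j M - s)\<bar> \<le> 2 * \<bar>B j j M - s\<bar>"
        using mult_right_mono[of "\<bar>s\<bar>" 1 "\<bar>B j j M - s\<bar>"] s_le_1 by (simp add: abs_mult abs_square_le_1)
      finally show "\<bar>s\<^sup>2 - (B j j M)\<^sup>2\<bar> \<le> (B j j M - s)\<^sup>2 + 2 * \<bar>B j j M - s\<bar>" by simp
    qed auto
    finally show ?thesis unfolding ra .
  qed
  finally show ?thesis
    unfolding Ceq a_def by simp
qed

lemma average_moved_sum_deviation:
  "(\<Sum>\<sigma> | \<sigma> permutes {..<n}. \<integral>M. \<bar>moved_sum \<sigma> M - (1 - s\<^sup>2)\<bar> \<partial>H) / fact n \<le> sqrt avg_dev"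
proof -
  let ?P = "{\<sigma>. \<sigma> permutes {..<n}}"
  let ?D = "\<lambda>\<sigma> M. moved_sum \<sigma> M - (1 - s\<^sup>2)"
  define \<eta> where "\<eta> = sqrt avg_dev"
  have \<eta>: "\<eta> > 0" "\<eta> * \<eta> = avg_dev"
    using avg_dev_pos by (simp_all add: \<eta>_def)
  have n: "real n > 1"
    using n_ge_2 by simp
  note bi = integrable_bdd_measurable bdd_measurable_intros bdd_measurable_B bdd_measurable_moved_sum
  have sq: "(\<Sum>\<sigma>\<in>?P. \<integral>M. (?D \<sigma> M)\<^sup>2 \<partial>H) / fact n \<le> avg_dev"
  proof -
    have "(\<Sum>\<sigma>\<in>?P. \<integral>M. (?D \<sigma> M)\<^sup>2 \<partial>H) / fact n = (\<integral>M. (\<Sum>\<sigma>\<in>?P. (?D \<sigma> M)\<^sup>2) / fact n \<partial>H)"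
      by (simp add: bi Bochner_Integration.integral_sum)
    also have "\<dots> \<le> (\<integral>M. (\<Sum>j<n. \<Sum>l\<in>{..<n} - {j}. B j l M ^ 4) / real n + 1 / (real n - 1)
      + (\<Sum>j<n. (B j j M - s)\<^sup>2 + 2 * \<bar>B j j M - s\<bar>) / real n \<partial>H)"
      by (rule integral_mono) (intro bi | rule sum_moved_sum_deviation | simp add: space_H)+
    also have "\<dots> = (\<Sum>j<n. \<Sum>l\<in>{..<n} - {j}. \<integral>M. B j l M ^ 4 \<partial>H) / real n + 1 / (real n - 1)
      + (\<Sum>j<n. (\<integral>M. (B j j M - s)\<^sup>2 \<partial>H) + 2 * (\<integral>M. \<bar>B j j M - s\<bar> \<partial>H)) / real n"
      by (simp add: bi Bochner_Integration.integral_sum prob_space)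
    also have "\<dots> \<le> (\<Sum>j<n. \<Sum>l\<in>{..<n} - {j}. 9 / (real n - 1)\<^sup>2) / real n + 1 / (real n - 1)
      + (\<Sum>j<n. diag_dev + 2 * sqrt diag_dev) / real n"
      by (intro add_mono divide_right_mono sum_mono mult_left_mono offdiagonal_fourth_moment
          diagonal_second_moment expectation_abs_le_sqrt bi order_refl) auto
    also have "\<dots> \<le> (\<Sum>j<n. \<Sum>l<n. 9 / (real n - 1)\<^sup>2) / real n + 1 / (real n - 1)
      + (\<Sum>j<n. diag_dev + 2 * sqrt diag_dev) / real n"
      by (intro add_mono divide_right_mono sum_mono sum_mono2 order_refl) auto
    also have "\<dots> = avg_dev"
      using n by (simp add: avg_dev_def)
    finally show ?thesis .
  qed
  \<comment> \<open>Young's inequality for each \<open>\<sigma>\<close> separately; with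
    \<open>\<eta>\<close> the square root of the mean square bound, the average over
    \<open>\<sigma>\<close> comes out as \<open>\<eta>\<close>, as Cauchy-Schwarz on the product
    space would give.\<close>
  have "(\<integral>M. \<bar>?D \<sigma> M\<bar> \<partial>H) \<le> (\<integral>M. (?D \<sigma> M)\<^sup>2 \<partial>H) / (2 * \<eta>) + \<eta> / 2" for \<sigma>
  proof -
    have "(\<integral>M. \<bar>?D \<sigma> M\<bar> \<partial>H) \<le> (\<integral>M. (?D \<sigma> M)\<^sup>2 / (2 * \<eta>) + \<eta> / 2 \<partial>H)"
    proof (rule integral_mono)
      fix M
      show "\<bar>?D \<sigma> M\<bar> \<le> (?D \<sigma> M)\<^sup>2 / (2 * \<eta>) + \<eta> / 2"
        using sum_squares_bound[of "\<bar>?D \<sigma> M\<bar>" \<eta>] \<eta>(1)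
        by (simp add: field_simps power2_eq_square)
    qed (intro bi)+
    also have "\<dots> = (\<integral>M. (?D \<sigma> M)\<^sup>2 \<partial>H) / (2 * \<eta>) + \<eta> / 2"
      by (simp add: bi prob_space)
    finally show ?thesis .
  qed
  then have "(\<Sum>\<sigma>\<in>?P. \<integral>M. \<bar>?D \<sigma> M\<bar> \<partial>H) / fact n
      \<le> (\<Sum>\<sigma>\<in>?P. (\<integral>M. (?D \<sigma> M)\<^sup>2 \<partial>H) / (2 * \<eta>) + \<eta> / 2) / fact n"
    by (intro divide_right_mono sum_mono) auto
  also have "\<dots> = (\<Sum>\<sigma>\<in>?P. \<integral>M. (?D \<sigma> M)\<^sup>2 \<partial>H) / fact n / (2 * \<eta>) + \<eta> / 2"
    by (simp add: sum.distrib card_permutations add_divide_distrib flip: sum_divide_distrib)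
  also have "\<dots> \<le> avg_dev / (2 * \<eta>) + \<eta> / 2"
    using sq \<eta>(1) by (intro add_mono divide_right_mono) auto
  also have "\<dots> = \<eta>"
    using \<eta> by (simp add: field_simps)
  finally show ?thesis
    by (simp add: \<eta>_def)
qed

text \<open>The conditional bound is averaged term by term: the mean number of fixed points is 1 and
  the mean number of cycle minima is at most \<open>harm n\<close>.\<close>

lemma averaged_char_bound:
  "cmod ((\<Sum>\<sigma> | \<sigma> permutes {..<n}. \<integral>M. iexp (t * (\<Sum>j<n. B j (\<sigma> j) M)) \<partial>H) / fact n
      - (\<Sum>\<sigma> | \<sigma> permutes {..<n}. iexp (t * s) ^ card (fixed_points n \<sigma>)) / fact n
         * of_real (exp (- (t\<^sup>2 * (1 - s\<^sup>2) / 2))))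
   \<le> \<bar>t\<bar> * (sqrt diag_dev + harm n * sqrt (3 / (real n - 1)))
       + t ^ 4 * (9 * real n / (real n - 1)\<^sup>2)
       + t\<^sup>2 / 2 * (sqrt avg_dev + harm n * (3 / (real n - 1)))"
proof -
  let ?P = "{\<sigma>. \<sigma> permutes {..<n}}"
  define g where "g = complex_of_real (exp (- (t\<^sup>2 * (1 - s\<^sup>2) / 2)))"
  define d where "d \<sigma> = (\<integral>M. iexp (t * (\<Sum>j<n. B j (\<sigma> j) M)) \<partial>H) - iexp (t * s) ^ card (fixed_points n \<sigma>) * g" for \<sigma>
  define D where "D \<sigma> = (\<integral>M. \<bar>moved_sum \<sigma> M - (1 - s\<^sup>2)\<bar> \<partial>H)" for \<sigma>
  define T where "T \<sigma> = real (card (cycle_minima n \<sigma>))" for \<sigma>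
  define F where "F \<sigma> = real (card (fixed_points n \<sigma>))" for \<sigma>
  define v where "v = sqrt (3 / (real n - 1))"
  define w where "w = 3 / (real n - 1)"
  define e where "e = 9 * real n / (real n - 1)\<^sup>2"
  have n: "real n > 1"
    using n_ge_2 by simp
  have vw: "v \<ge> 0" "w \<ge> 0"
    using n by (simp_all add: v_def w_def)
  have "cmod ((\<Sum>\<sigma>\<in>?P. \<integral>M. iexp (t * (\<Sum>j<n. B j (\<sigma> j) M)) \<partial>H) / fact n
      - (\<Sum>\<sigma>\<in>?P. iexp (t * s) ^ card (fixed_points n \<sigma>)) / fact n * g) = cmod (\<Sum>\<sigma>\<in>?P. d \<sigma>) / fact n"
  proof -
    have "(\<Sum>\<sigma>\<in>?P. \<integral>M. iexp (t * (\<Sum>j<n. B j (\<sigma> j) M)) \<partial>H) / fact n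
      - (\<Sum>\<sigma>\<in>?P. iexp (t * s) ^ card (fixed_points n \<sigma>)) / fact n * g = (\<Sum>\<sigma>\<in>?P. d \<sigma>) / fact n"
      unfolding d_def sum_subtractf by (simp add: diff_divide_distrib sum_distrib_right)
    then show ?thesis
      by (simp add: norm_divide)
  qed
  also have "\<dots> \<le> (\<Sum>\<sigma>\<in>?P. cmod (d \<sigma>)) / fact n"
    by (intro divide_right_mono norm_sum) auto
  also have "\<dots> \<le> (\<Sum>\<sigma>\<in>?P. \<bar>t\<bar> * (F \<sigma> * sqrt diag_dev + T \<sigma> * v) + t ^ 4 * e + t\<^sup>2 / 2 * (D \<sigma> + T \<sigma> * w)) / fact n"
    unfolding d_def g_def D_def T_def F_def v_def w_def e_def
    by (intro divide_right_mono sum_mono conditional_char_bound) auto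
  also have "\<dots> = \<bar>t\<bar> * ((\<Sum>\<sigma>\<in>?P. F \<sigma>) / fact n * sqrt diag_dev + (\<Sum>\<sigma>\<in>?P. T \<sigma>) / fact n * v) + t ^ 4 * e
      + t\<^sup>2 / 2 * ((\<Sum>\<sigma>\<in>?P. D \<sigma>) / fact n + (\<Sum>\<sigma>\<in>?P. T \<sigma>) / fact n * w)"
  proof -
    have "(\<Sum>\<sigma>\<in>?P. \<bar>t\<bar> * (F \<sigma> * sqrt diag_dev + T \<sigma> * v) + t ^ 4 * e + t\<^sup>2 / 2 * (D \<sigma> + T \<sigma> * w))
       = \<bar>t\<bar> * (sum F ?P * sqrt diag_dev + sum T ?P * v) + fact n * (t ^ 4 * e) + t\<^sup>2 / 2 * (sum D ?P + sum T ?P * w)"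
      by (simp only: sum.distrib sum_distrib_left[symmetric] sum_distrib_right[symmetric] sum_constant)
        (simp add: card_permutations)
    then show ?thesis
      by (simp add: field_simps)
  qed
  also have "\<dots> \<le> \<bar>t\<bar> * (1 * sqrt diag_dev + harm n * v) + t ^ 4 * e + t\<^sup>2 / 2 * (sqrt avg_dev + harm n * w)"
  proof -
    have T: "(\<Sum>\<sigma>\<in>?P. T \<sigma>) / fact n \<le> harm n"
      using sum_card_cycle_minima_le[of n] unfolding T_def by (simp add: divide_le_eq mult.commute)
    have F: "(\<Sum>\<sigma>\<in>?P. F \<sigma>) / fact n \<le> 1"
      using sum_card_fixed_points[of n] n_ge_2 unfolding F_def by simp
    have D: "(\<Sum>\<sigma>\<in>?P. D \<sigma>) / fact n \<le> sqrt avg_dev"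
      using average_moved_sum_deviation unfolding D_def .
    show ?thesis
      using vw diag_dev_nonneg
      by (intro add_mono mult_left_mono mult_right_mono T F D order_refl) auto
  qed
  finally show ?thesis
    unfolding g_def v_def w_def e_def by simp
qed

end

section \<open>Characteristic functions\<close>

lemma poisson_char:
  "(\<integral>k. iexp (u * real k) \<partial>measure_pmf (poisson_pmf 1)) = exp (iexp u - 1)"
proof -
  let ?f = "\<lambda>k::nat. (1 / fact k * exp (- 1)) *\<^sub>R iexp (u * real k)"
  have "(\<lambda>k. iexp u ^ k /\<^sub>R fact k) sums exp (iexp u)"
    by (rule exp_converges)
  then have "(\<lambda>k. exp (- 1) * (iexp u ^ k /\<^sub>R fact k)) sums (exp (- 1) * exp (iexp u))"
    by (rule sums_mult)
  moreover have "exp (- 1) * (iexp u ^ k /\<^sub>R fact k) = ?f k" for k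
    by (simp add: scaleR_conv_of_real exp_of_nat_mult[symmetric] exp_of_real[symmetric] field_simps)
  ultimately have sums: "?f sums exp (iexp u - 1)"
    by (simp add: exp_diff exp_minus field_simps)
  have int: "integrable (count_space UNIV) ?f"
  proof -
    have "summable (\<lambda>k. norm (?f k))"
      using summable_mult[OF summable_exp[of "1::real"], of "exp (- 1)"] by (simp add: field_simps)
    then show ?thesis
      by (simp add: integrable_count_space_nat_iff)
  qed
  have "(\<integral>k. iexp (u * real k) \<partial>measure_pmf (poisson_pmf 1)) = (\<integral>k. ?f k \<partial>count_space UNIV)"
    unfolding measure_pmf_eq_density by (subst integral_density) auto
  also have "\<dots> = (\<Sum>k. ?f k)"
    by (rule integral_count_space_nat[OF int])
  also have "\<dots> = exp (iexp u - 1)"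
    using sums by (rule sums_unique[symmetric])
  finally show ?thesis .
qed

lemma limit_law_measurable:
  "(\<lambda>(g, k). sqrt (1 - s\<^sup>2) * g + s * real k)
     \<in> borel_measurable (density lborel std_normal_density \<Otimes>\<^sub>M measure_pmf (poisson_pmf 1))"
  by measurable

lemma real_distribution_limit_law: "real_distribution (limit_law s)"
proof -
  interpret N: prob_space "density lborel std_normal_density"
    by (rule prob_space_normal_density) simp
  interpret pair_prob_space "density lborel std_normal_density" "measure_pmf (poisson_pmf 1)" ..
  show ?thesis
    unfolding limit_law_def by (intro real_distribution_distr limit_law_measurable)
qed

lemma char_limit_law:
  assumes "s\<^sup>2 \<le> 1"
  shows "char (limit_law s) t = exp (iexp (t * s) - 1) * of_real (exp (- (t\<^sup>2 * (1 - s\<^sup>2) / 2)))"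
proof -
  let ?N = "density lborel std_normal_density" and ?P = "measure_pmf (poisson_pmf 1)"
  let ?c = "sqrt (1 - s\<^sup>2)"
  interpret N: prob_space ?N
    by (rule prob_space_normal_density) simp
  interpret pair_prob_space ?N ?P ..
  let ?f = "\<lambda>x. iexp (t * (case x of (g, k) \<Rightarrow> ?c * g + s * real k))"
  have int: "integrable (?N \<Otimes>\<^sub>M ?P) ?f"
    using limit_law_measurable[of s] by (intro integrable_const_bound[where B = 1]) auto
  have "char (limit_law s) t = integral\<^sup>L (?N \<Otimes>\<^sub>M ?P) ?f"
    unfolding limit_law_def char_def by (subst integral_distr[OF limit_law_measurable]) auto
  also have "\<dots> = (\<integral>g. (\<integral>k. ?f (g, k) \<partial>?P) \<partial>?N)"
    by (rule integral_fst'[OF int, symmetric])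
  also have "\<dots> = (\<integral>g. iexp ((t * ?c) * g) * exp (iexp (t * s) - 1) \<partial>?N)"
  proof (intro Bochner_Integration.integral_cong refl)
    fix g
    have "(\<integral>k. ?f (g, k) \<partial>?P) = (\<integral>k. iexp ((t * ?c) * g) * iexp ((t * s) * real k) \<partial>?P)"
      by (intro Bochner_Integration.integral_cong refl) (simp add: algebra_simps flip: exp_add)
    then show "(\<integral>k. ?f (g, k) \<partial>?P) = iexp ((t * ?c) * g) * exp (iexp (t * s) - 1)"
      by (simp only: integral_mult_right_zero poisson_char)
  qed
  also have "\<dots> = char ?N (t * ?c) * exp (iexp (t * s) - 1)"
    unfolding char_def by (rule integral_mult_left_zero)
  also have "char ?N (t * ?c) = of_real (exp (- (t\<^sup>2 * (1 - s\<^sup>2) / 2)))"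
    using assms by (simp add: char_std_normal_distribution power_mult_distrib)
  finally show ?thesis by (simp add: mult.commute)
qed

section \<open>The law of the trace\<close>

lemma trace_law_measurable:
  assumes "haar_orth n H"
  shows "(\<lambda>(M, \<sigma>). mat_trace n (mat_mult n (mat_mult n (mat_mult n A M) (perm_mat \<sigma>)) (transp_mat M)))
     \<in> borel_measurable (H \<Otimes>\<^sub>M unif_perm n)"
proof -
  interpret haar_measure n H by unfold_locales fact
  have [measurable]: "(\<lambda>x. fst x i j) \<in> borel_measurable (H \<Otimes>\<^sub>M unif_perm n)" for i j
    by (rule measurable_compose[OF measurable_fst entry_measurable])
  have [measurable]: "(\<lambda>x. perm_mat (snd x) i j) \<in> borel_measurable (H \<Otimes>\<^sub>M unif_perm n)" for i j
    by (rule measurable_compose[OF measurable_snd]) (simp add: unif_perm_def)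
  show ?thesis
    unfolding case_prod_beta mat_trace_def mat_mult_def transp_mat_def by measurable
qed

lemma prob_space_unif_perm: "prob_space (unif_perm n)"
  unfolding unif_perm_def by (rule prob_space_measure_pmf)

lemma real_distribution_trace_law:
  assumes "haar_orth n H"
  shows "real_distribution (trace_law n H A)"
proof -
  interpret haar_measure n H by unfold_locales fact
  interpret U: prob_space "unif_perm n" by (rule prob_space_unif_perm)
  interpret P: pair_prob_space H "unif_perm n" ..
  show ?thesis
    unfolding trace_law_def by (intro P.real_distribution_distr trace_law_measurable assms)
qed

text \<open>Fubini with the permutation outermost leaves a finite average of Haar integrals with
  \<open>\<sigma>\<close> fixed, the form in which the bounds are stated.\<close>

lemma char_trace_law:
  assumes "haar_orth n H"
  shows "char (trace_law n H A) t =
    (\<Sum>\<sigma> | \<sigma> permutes {..<n}. \<integral>M. iexp (t * (\<Sum>j<n. conj_entry n A M j (\<sigma> j))) \<partial>H) / fact n"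
proof -
  interpret haar_measure n H by unfold_locales fact
  interpret U: prob_space "unif_perm n" by (rule prob_space_unif_perm)
  interpret P: pair_prob_space H "unif_perm n" ..
  let ?S = "{\<sigma>. \<sigma> permutes {..<n}}"
  define W where "W = (\<lambda>(M, \<sigma>). mat_trace n (mat_mult n (mat_mult n (mat_mult n A M) (perm_mat \<sigma>)) (transp_mat M)))"
  let ?f = "\<lambda>M \<sigma>. iexp (t * W (M, \<sigma>))"
  have S: "finite ?S" "?S \<noteq> {}"
    by (auto simp: finite_permutations intro!: exI[of _ id] permutes_id)
  have W [measurable]: "W \<in> borel_measurable (H \<Otimes>\<^sub>M unif_perm n)"
    unfolding W_def by (rule trace_law_measurable[OF assms])
  have f: "case_prod ?f = (\<lambda>x. iexp (t * W x))"
    by auto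
  have int: "integrable (H \<Otimes>\<^sub>M unif_perm n) (case_prod ?f)"
    unfolding f by (rule P.integrable_const_bound[where B = 1]) auto
  have "char (trace_law n H A) t = integral\<^sup>L (H \<Otimes>\<^sub>M unif_perm n) (case_prod ?f)"
    unfolding trace_law_def char_def f W_def[symmetric] by (rule integral_distr) auto
  also have "\<dots> = (\<integral>\<sigma>. (\<integral>M. ?f M \<sigma> \<partial>H) \<partial>unif_perm n)"
    by (rule P.integral_snd[OF int, symmetric])
  also have "\<dots> = (\<Sum>\<sigma>\<in>?S. pmf (pmf_of_set ?S) \<sigma> *\<^sub>R (\<integral>M. ?f M \<sigma> \<partial>H))"
    unfolding unif_perm_def using S by (intro integral_measure_pmf) auto
  also have "\<dots> = (\<Sum>\<sigma>\<in>?S. (\<integral>M. iexp (t * (\<Sum>j<n. conj_entry n A M j (\<sigma> j))) \<partial>H) / fact n)"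
    using S by (intro sum.cong refl)
      (simp add: W_def trace_conj_perm card_permutations scaleR_conv_of_real divide_inverse mult.commute)
  finally show ?thesis
    by (simp add: sum_divide_distrib)
qed

section \<open>The limit theorem\<close>

text \<open>\<open>harm n - ln n\<close> converges to the Euler-Mascheroni constant, so harmonic
  numbers may be traded for logarithms, whose limits are automatic.\<close>

lemma harm_mult_tendsto_0:
  fixes f :: "nat \<Rightarrow> real"
  assumes "f \<longlonglongrightarrow> 0" "(\<lambda>n. ln (real n) * f n) \<longlonglongrightarrow> 0"
  shows "(\<lambda>n. harm n * f n) \<longlonglongrightarrow> 0"
proof -
  have "(\<lambda>n. (harm n - ln (real n)) * f n + ln (real n) * f n) \<longlonglongrightarrow> euler_mascheroni * 0 + 0"
    by (intro tendsto_intros euler_mascheroni_LIMSEQ assms)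
  then show ?thesis
    by (simp add: algebra_simps)
qed

text \<open>Cauchy-Schwarz on the diagonal, whose squares sum to at most \<open>n\<close>. In the
  limit it yields \<open>s\<^sup>2 \<le> 1\<close>.\<close>

lemma normalized_trace_square_le_1:
  fixes A :: "nat \<Rightarrow> nat \<Rightarrow> real"
  assumes "(\<Sum>i<n. \<Sum>k<n. (A i k)\<^sup>2) = real n"
  shows "((1 / real n) * (\<Sum>i<n. A i i))\<^sup>2 \<le> 1"
proof (cases "n = 0")
  case False
  have "(\<Sum>i<n. A i i)\<^sup>2 \<le> (\<Sum>i<n. (A i i)\<^sup>2) * real n"
    using sum_squared_le_sum_of_squares[of "\<lambda>i. A i i" "{..<n}"] by simp
  also have "(\<Sum>i<n. (A i i)\<^sup>2) \<le> (\<Sum>i<n. \<Sum>k<n. (A i k)\<^sup>2)"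
    by (intro sum_mono member_le_sum) auto
  finally have "(\<Sum>i<n. A i i)\<^sup>2 \<le> (real n)\<^sup>2"
    by (simp only: assms) (simp add: power2_eq_square mult_right_mono)
  then show ?thesis
    using False by (simp add: power_divide divide_le_eq)
qed simp

theorem theorem3p4:
  fixes A :: "nat \<Rightarrow> nat \<Rightarrow> nat \<Rightarrow> real"
    and H :: "nat \<Rightarrow> (nat \<Rightarrow> nat \<Rightarrow> real) measure"
    and s :: real
  assumes norm: "\<And>n. mat_trace n (mat_mult n (transp_mat (A n)) (A n)) = real n"
    and diag: "(\<lambda>n. (1 / real n) * (\<Sum>i<n. A n i i)) \<longlonglongrightarrow> s"
    and haar: "\<And>n. haar_orth n (H n)"
  shows "weak_conv_m (\<lambda>n. trace_law n (H n) (A n)) (limit_law s)"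
proof (rule levy_continuity)
  fix t :: real
  have normA: "(\<Sum>i<n. \<Sum>k<n. (A n i k)\<^sup>2) = real n" for n
    using norm[of n] by (simp add: trace_transp_mult_self)
  have s: "s\<^sup>2 \<le> 1"
    by (rule LIMSEQ_le_const2[OF tendsto_power[OF diag]]) (use normalized_trace_square_le_1[OF normA] in blast)
  \<comment> \<open>\<open>d\<close> and \<open>\<rho>\<close> are \<open>diag_dev\<close> and
    \<open>avg_dev\<close> written as sequences in \<open>n\<close>, outside the locale that fixes
    \<open>n\<close>.\<close>
  define d where "d n = ((\<Sum>i<n. A n i i) / real n - s)\<^sup>2 + 2 / real n" for n
  define \<rho> where "\<rho> n = 9 * real n / (real n - 1)\<^sup>2 + 1 / (real n - 1) + d n + 2 * sqrt (d n)" for n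
  define bound where "bound n = \<bar>t\<bar> * (sqrt (d n) + harm n * sqrt (3 / (real n - 1)))
       + t ^ 4 * (9 * real n / (real n - 1)\<^sup>2) + t\<^sup>2 / 2 * (sqrt (\<rho> n) + harm n * (3 / (real n - 1)))" for n
  define g where "g = complex_of_real (exp (- (t\<^sup>2 * (1 - s\<^sup>2) / 2)))"
  define G where "G n = (\<Sum>\<sigma> | \<sigma> permutes {..<n}. iexp (t * s) ^ card (fixed_points n \<sigma>)) / fact n * g" for n
  have d0: "d \<longlonglongrightarrow> 0"
  proof -
    have "(\<lambda>n. (1 / real n * (\<Sum>i<n. A n i i) - s)\<^sup>2 + 2 / real n) \<longlonglongrightarrow> (s - s)\<^sup>2 + 0"
      by (intro tendsto_intros diag)
    then show ?thesis
      by (simp add: d_def[abs_def])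
  qed
  have e0: "(\<lambda>n. 9 * real n / (real n - 1)\<^sup>2) \<longlonglongrightarrow> 0"
    by real_asymp
  have \<rho>0: "\<rho> \<longlonglongrightarrow> 0"
  proof -
    have "\<rho> \<longlonglongrightarrow> 0 + 0 + 0 + 2 * sqrt 0"
      unfolding \<rho>_def[abs_def] by (intro tendsto_intros d0 e0) real_asymp
    then show ?thesis by simp
  qed
  \<comment> \<open>This is the decisive comparison: logarithmically many dropped indices, each of
    order \<open>n\<close> to the power -1/2.\<close>
  have h1: "(\<lambda>n. harm n * sqrt (3 / (real n - 1))) \<longlonglongrightarrow> 0"
    by (rule harm_mult_tendsto_0) real_asymp+
  have h2: "(\<lambda>n. harm n * (3 / (real n - 1))) \<longlonglongrightarrow> 0"
    by (rule harm_mult_tendsto_0) real_asymp+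
  have "bound \<longlonglongrightarrow> \<bar>t\<bar> * (sqrt 0 + 0) + t ^ 4 * 0 + t\<^sup>2 / 2 * (sqrt 0 + 0)"
    unfolding bound_def[abs_def] by (intro tendsto_intros d0 e0 \<rho>0 h1 h2)
  then have bound0: "bound \<longlonglongrightarrow> 0"
    by simp
  have "\<forall>\<^sub>F n in sequentially. cmod (char (trace_law n (H n) (A n)) t - G n) \<le> bound n"
    using eventually_ge_at_top[of 2]
  proof eventually_elim
    case (elim n)
    interpret haar_conj n "H n" "A n" s
      using haar[of n] normA[of n] elim s by unfold_locales
    show ?case
      using averaged_char_bound[of t] unfolding char_trace_law[OF haar] G_def g_def bound_def
        \<rho>_def d_def avg_dev_def diag_dev_def .
  qed
  then have "(\<lambda>n. char (trace_law n (H n) (A n)) t - G n) \<longlonglongrightarrow> 0"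
    by (rule Lim_null_comparison[OF _ bound0])
  moreover have "G \<longlonglongrightarrow> exp (iexp (t * s) - 1) * g"
    unfolding G_def[abs_def] by (intro tendsto_intros fixed_points_generating_function_tendsto)
  ultimately have "(\<lambda>n. (char (trace_law n (H n) (A n)) t - G n) + G n) \<longlonglongrightarrow> 0 + exp (iexp (t * s) - 1) * g"
    by (rule tendsto_add)
  then show "(\<lambda>n. char (trace_law n (H n) (A n)) t) \<longlonglongrightarrow> char (limit_law s) t"
    by (simp add: char_limit_law[OF s] g_def)
qed (intro real_distribution_trace_law haar real_distribution_limit_law)+

end
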